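(* Let $K$ be an infinite field. (a) Let $\Gamma$ be a connected graph with $n$ vertices and $e$ edges. Assume that $e=2n-4$ and that the vertices can be ordered as $x_1,\dots,x_n$ in such a way that for each $i\ge3$ there are at least two edges connecting $x_i$ to $\{x_1,\dots,x_{i-1}\}$. Then $R=R_\Gamma/(l_1,l_2)$ has the Weak Lefschetz Property (WLP) for $l_1,l_2$ a system of parameters consisting of linear forms with generic coefficients. (b) Assume moreover that $\Gamma$ is bipartite with vertex set $\{x_1,\dots,x_p,y_1,\dots,y_q\}$, $p+q=n$, all edges being of the form $\{x_i,y_j\}$, and let $l_1=\sum_{i=1}^pX_i$ and $l_2=\sum_{j=1}^qY_j$, where $X_i,Y_j$ are the variables corresponding to $x_i,y_j$. Then $R=R_\Gamma/(l_1,l_2)$ admits a pair of exact zero divisors.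
   Context: For a graph $\Gamma=(V,E)$ with vertices $v_1,\dots,v_n$, the Stanley–Reisner ring over $K$ is $R_\Gamma=K[T_1,\dots,T_n]/I_\Gamma$, with one variable $T_i$ for each vertex $v_i$, where $I_\Gamma$ is generated by all monomials $T_iT_j$ ($i\neq j$) with $\{v_i,v_j\}\notin E$ and all monomials $T_iT_jT_m$ with distinct $i,j,m$. Since $\Gamma$ is connected, $R_\Gamma$ is two-dimensional Cohen–Macaulay. The quotient $R$ of $R_\Gamma$ by a system of parameters consisting of two linear forms is graded, $R=K\oplus R_1\oplus R_2$, with $\dim_KR_1=n-2$ and $\dim_KR_2=e-n+1$, which equals $\dim_KR_1-1$ when $e=2n-4$. For such a ring with $\dim_KR_2=\dim_KR_1-1$, $R$ has WLP if there exists $z\in R_1$ such that the multiplication map $z\cdot:R_1\to R_2$ is surjective. "Linear forms with generic coefficients" means that the coefficient vector of $(l_1,l_2)$ lies in a suitable non-empty Zariski open subset of $K^{2n}$. A pair of exact zero divisors in a ring $A$ is a pair of elements $a,b\in A$, both non-units, with $\mathrm{Ann}_A(a)=(b)$ and $\mathrm{Ann}_A(b)=(a)$. *)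

theory Defs
  imports
    "HOL-Library.Poly_Mapping"
    "HOL-Library.Extended_Nat"
    "HOL-Library.Cardinality"
    "HOL-Algebra.QuotRing"
    "HOL-Algebra.Embedded_Algebras"
    "HOL-Algebra.Algebraic_Closure_Type"
begin

section \<open>Graphs\<close>

text \<open>
  The vertex set of a graph is the whole of a finite type, and a graph on it is given by its
  set of edges, each edge being a set of two vertices.
\<close>

definition simple_graph :: "'v set set \<Rightarrow> bool" where
  "simple_graph E \<longleftrightarrow> (\<forall>e\<in>E. card e = 2)"

definition connected_graph :: "'v set set \<Rightarrow> bool" where
  "connected_graph E \<longleftrightarrow> (\<forall>u v. (u, v) \<in> {(a, b). {a, b} \<in> E}\<^sup>*)"

definition bipartition :: "'v set set \<Rightarrow> 'v set \<Rightarrow> 'v set \<Rightarrow> bool" where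
  "bipartition E A B \<longleftrightarrow>
     A \<union> B = UNIV \<and> A \<inter> B = {} \<and> (\<forall>e\<in>E. \<exists>x\<in>A. \<exists>y\<in>B. e = {x, y})"


section \<open>Polynomials\<close>

type_synonym ('i, 'k) mpoly = "('i \<Rightarrow>\<^sub>0 nat) \<Rightarrow>\<^sub>0 'k"

definition Var :: "'i \<Rightarrow> ('i, 'k::field) mpoly" where
  "Var i = Poly_Mapping.single (Poly_Mapping.single i 1) 1"

definition Const :: "'k::field \<Rightarrow> ('i, 'k) mpoly" where
  "Const k = Poly_Mapping.single 0 k"

definition peval :: "('i \<Rightarrow> 'k::field) \<Rightarrow> ('i, 'k) mpoly \<Rightarrow> 'k" where
  "peval c f = (\<Sum>m\<in>Poly_Mapping.keys f. Poly_Mapping.lookup f m *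
     (\<Prod>i\<in>Poly_Mapping.keys m. c i ^ Poly_Mapping.lookup m i))"

definition homogeneous :: "nat \<Rightarrow> ('i, 'k::field) mpoly \<Rightarrow> bool" where
  "homogeneous d f \<longleftrightarrow> (\<forall>m\<in>Poly_Mapping.keys f.
     (\<Sum>i\<in>Poly_Mapping.keys m. Poly_Mapping.lookup m i) = d)"

definition linear_form :: "('i::finite \<Rightarrow> 'k::field) \<Rightarrow> ('i, 'k) mpoly" where
  "linear_form a = (\<Sum>i\<in>UNIV. Const (a i) * Var i)"

definition zariski_closed :: "('i \<Rightarrow> 'k::field) set \<Rightarrow> bool" where
  "zariski_closed Z \<longleftrightarrow> (\<exists>S :: ('i, 'k) mpoly set. Z = {c. \<forall>f\<in>S. peval c f = 0})"

definition zariski_open :: "('i \<Rightarrow> 'k::field) set \<Rightarrow> bool" where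
  "zariski_open U \<longleftrightarrow> zariski_closed (- U)"


section \<open>Commutative rings\<close>

text \<open>The supremum of the lengths of chains of prime ideals; a chain with \<open>n + 1\<close> members has
  length \<open>n\<close>.\<close>

definition krull_dim :: "('a, 'm) ring_scheme \<Rightarrow> enat" where
  "krull_dim A = (SUP Ps \<in> {Ps. Ps \<noteq> [] \<and> (\<forall>P\<in>set Ps. primeideal P A) \<and> sorted_wrt (\<subset>) Ps}.
     enat (length Ps - 1))"

definition Ann :: "('a, 'm) ring_scheme \<Rightarrow> 'a \<Rightarrow> 'a set" where
  "Ann A a = {r \<in> carrier A. r \<otimes>\<^bsub>A\<^esub> a = \<zero>\<^bsub>A\<^esub>}"

definition exact_zero_divisors :: "('a, 'm) ring_scheme \<Rightarrow> 'a \<Rightarrow> 'a \<Rightarrow> bool" where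
  "exact_zero_divisors A a b \<longleftrightarrow>
     a \<in> carrier A \<and> b \<in> carrier A \<and> a \<notin> Units A \<and> b \<notin> Units A \<and>
     Ann A a = PIdl\<^bsub>A\<^esub> b \<and> Ann A b = PIdl\<^bsub>A\<^esub> a"


section \<open>The Stanley-Reisner ring and its quotients\<close>

abbreviation mpoly_ring :: "('i, 'k::field) mpoly ring" where
  "mpoly_ring \<equiv> ring_of_type_algebra"

definition SR_ideal :: "'v set set \<Rightarrow> ('v, 'k::field) mpoly set" where
  "SR_ideal E = Idl\<^bsub>mpoly_ring\<^esub>
     ({Var i * Var j | i j. i \<noteq> j \<and> {i, j} \<notin> E} \<union>
      {Var i * Var j * Var m | i j m. i \<noteq> j \<and> i \<noteq> m \<and> j \<noteq> m})"

text \<open>Here \<open>SR_class E f\<close> is the residue class of the polynomial \<open>f\<close> in \<open>SR_ring E\<close>, and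
  \<open>SR_quot_class E L f\<close> its class in \<open>SR_quot E L\<close>, the quotient of \<open>SR_ring E\<close> by the ideal
  generated by the classes of the polynomials in \<open>L\<close>.\<close>

definition SR_ring :: "'v set set \<Rightarrow> ('v, 'k::field) mpoly set ring" where
  "SR_ring E = mpoly_ring Quot SR_ideal E"

definition SR_class :: "'v set set \<Rightarrow> ('v, 'k::field) mpoly \<Rightarrow> ('v, 'k) mpoly set" where
  "SR_class E f = SR_ideal E +>\<^bsub>mpoly_ring\<^esub> f"

definition SR_quot_ideal ::
  "'v set set \<Rightarrow> ('v, 'k::field) mpoly set \<Rightarrow> ('v, 'k) mpoly set set" where
  "SR_quot_ideal E L = Idl\<^bsub>SR_ring E\<^esub> (SR_class E ` L)"

definition SR_quot ::
  "'v set set \<Rightarrow> ('v, 'k::field) mpoly set \<Rightarrow> ('v, 'k) mpoly set set ring" where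
  "SR_quot E L = SR_ring E Quot SR_quot_ideal E L"

definition SR_quot_class ::
  "'v set set \<Rightarrow> ('v, 'k::field) mpoly set \<Rightarrow> ('v, 'k) mpoly \<Rightarrow> ('v, 'k) mpoly set set" where
  "SR_quot_class E L f = SR_quot_ideal E L +>\<^bsub>SR_ring E\<^esub> SR_class E f"

text \<open>The graded piece of degree \<open>d\<close>; meaningful when \<open>L\<close> consists of homogeneous polynomials.\<close>

definition SR_quot_deg ::
  "'v set set \<Rightarrow> ('v, 'k::field) mpoly set \<Rightarrow> nat \<Rightarrow> ('v, 'k) mpoly set set set" where
  "SR_quot_deg E L d = SR_quot_class E L ` {f. homogeneous d f}"

text \<open>A homogeneous system of parameters of \<open>SR_ring E\<close>: homogeneous elements of positive degree,
  as many as the dimension of the ring, such that the quotient by them has finite length, that is,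
  finite dimension over the field of constants.\<close>

definition SR_system_of_parameters :: "'v set set \<Rightarrow> ('v, 'k::field) mpoly list \<Rightarrow> bool" where
  "SR_system_of_parameters E ls \<longleftrightarrow>
     (\<forall>l\<in>set ls. \<exists>d>0. homogeneous d l) \<and>
     krull_dim (SR_ring E :: ('v, 'k) mpoly set ring) = enat (length ls) \<and>
     ring.finite_dimension (SR_quot E (set ls))
       (SR_quot_class E (set ls) ` range Const) (carrier (SR_quot E (set ls)))"

text \<open>The weak Lefschetz property of a graded quotient \<open>R = K \<oplus> R\<^sub>1 \<oplus> R\<^sub>2\<close> with
  \<open>dim R\<^sub>2 = dim R\<^sub>1 - 1\<close>, where maximal rank of \<open>z : R\<^sub>1 \<rightarrow> R\<^sub>2\<close> means surjectivity.\<close>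

definition SR_quot_WLP :: "'v set set \<Rightarrow> ('v, 'k::field) mpoly set \<Rightarrow> bool" where
  "SR_quot_WLP E L \<longleftrightarrow> (\<exists>z \<in> SR_quot_deg E L 1.
     (\<lambda>x. z \<otimes>\<^bsub>SR_quot E L\<^esub> x) ` SR_quot_deg E L 1 = SR_quot_deg E L 2)"

end

theory Submission
  imports Defs "HOL-Computational_Algebra.Polynomial"
begin

text \<open>
  Let \<open>l\<^sub>1\<close> and \<open>l\<^sub>2\<close> be linear forms with coefficient vectors \<open>a\<close> and \<open>b\<close>. The whole of part (a)
  follows from the condition that \<open>a\<^sub>u b\<^sub>v - a\<^sub>v b\<^sub>u \<noteq> 0\<close> for every edge \<open>{u, v}\<close>, which defines a
  Zariski open set; over an infinite field it is not empty, since \<open>a = 1\<close> and an injective \<open>b\<close> satisfy it.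

  Counting edges shows that, in the given ordering, each vertex from the third on has exactly two earlier
  neighbours, that there are no further edges, and so that the first two vertices are not adjacent
  (\<open>two_back_graph_if_ordering\<close>). This structure replaces all dimension counts.

  System of parameters. The Krull dimension of the Stanley-Reisner ring is two
  (\<open>krull_dim_SR_ring\<close>): a prime ideal misses at most two variables, so that modulo the smallest member
  of a chain only two variables are left, while elements that separate the members of a chain
  \<open>P\<^sub>0 \<subset> P\<^sub>1 \<subset> P\<^sub>2 \<subset> P\<^sub>3\<close> are algebraically independent modulo \<open>P\<^sub>0\<close>; three polynomials in two variables
  are not, by a count of monomials. The quotient \<open>R\<close> by \<open>l\<^sub>1, l\<^sub>2\<close> has finite dimension because all monomials of degree
  three vanish in it (\<open>cubic_mem_ideal\<close>): for an edge \<open>{u, v}\<close> the two relations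
  \<open>l\<^sub>k T\<^sub>u T\<^sub>v = 0\<close> involve only \<open>T\<^sub>u\<^sup>2 T\<^sub>v\<close> and \<open>T\<^sub>u T\<^sub>v\<^sup>2\<close>, and their determinant is the minor at that edge.

  Weak Lefschetz property. The multiplication by a linear form \<open>z\<close> is onto \<open>R\<^sub>2\<close> when all products of two
  variables vanish in \<open>R / z R\<close>. This is shown by descending along the ordering
  (\<open>quadrics_mem\<close>): once all products with later variables are known to vanish, the relations
  \<open>l\<^sub>1 T\<^sub>v = l\<^sub>2 T\<^sub>v = z T\<^sub>v = 0\<close> involve only \<open>T\<^sub>v\<^sup>2\<close>, \<open>T\<^sub>v T\<^sub>u\<close> and \<open>T\<^sub>v T\<^sub>w\<close> for the two earlier neighbours
  \<open>u\<close> and \<open>w\<close>, and what is needed is that a \<open>3 \<times> 3\<close> determinant is not zero. As a linear form in the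
  coefficients of \<open>z\<close>, this determinant has the minor at \<open>{u, v}\<close> as one of its coefficients, and so a suitable
  \<open>z\<close> exists.

  Exact zero divisors. In the bipartite case \<open>X\<^sub>i X\<^sub>j\<close> is zero in \<open>R\<close> for all \<open>i\<close> and \<open>j\<close>, also for \<open>i = j\<close> because
  of \<open>X\<^sub>i l\<^sub>1 = 0\<close>, and the same holds for the \<open>Y\<^sub>j\<close>. Let \<open>x = \<Sum> c\<^sub>i X\<^sub>i\<close> and \<open>y = \<Sum> d\<^sub>j Y\<^sub>j\<close> with distinct \<open>c\<^sub>i\<close> and distinct
  \<open>d\<^sub>j\<close>. Then \<open>(x + y) (x - y) = x\<^sup>2 - y\<^sup>2 = 0\<close>, and both factors satisfy the determinant condition above,
  so that multiplication by each of them is onto \<open>R\<^sub>2\<close>. It remains to see that the kernel of \<open>x + y\<close> on \<open>R\<^sub>1\<close> is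
  spanned by \<open>x - y\<close>. A linear form is in the kernel if and only if a system with one
  linear equation for each edge has a solution; along the ordering of the vertices a solution is determined by its
  values at the first two vertices, and these can be prescribed by obvious solutions
  (\<open>edge_equations_solution\<close>).
\<close>

section \<open>Polynomials\<close>

lemma Const_0 [simp]: "Const 0 = 0" by (simp add: Const_def)
lemma Const_1 [simp]: "Const 1 = 1" by (simp add: Const_def)
lemma Const_add: "Const (a + b) = Const a + Const b" by (simp add: Const_def single_add)
lemma Const_minus: "Const (- a) = - Const a" by (simp add: Const_def single_uminus)
lemma Const_diff: "Const (a - b) = Const a - Const b" by (simp add: Const_def single_diff)
lemma Const_mult: "Const (a * b) = Const a * Const b" by (simp add: Const_def mult_single)

lemmas Const_hom = Const_add Const_minus Const_diff Const_mult

lemma monomial_eq: 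
  "Poly_Mapping.single (m + Poly_Mapping.single v (Suc n)) c 
     = Var v * Poly_Mapping.single (m + Poly_Mapping.single v n) (c::'k::field)"
proof -
  have "Poly_Mapping.single v (Suc n) = Poly_Mapping.single v 1 + Poly_Mapping.single v n"
    by (simp flip: single_add)
  then show ?thesis by (simp add: Var_def mult_single add_ac)
qed

lemma poly_mapping_sum_singles:
  fixes f :: "'a \<Rightarrow>\<^sub>0 'b::comm_monoid_add"
  shows "f = (\<Sum>m\<in>Poly_Mapping.keys f. Poly_Mapping.single m (Poly_Mapping.lookup f m))"
  by (rule poly_mapping_eqI)
     (auto simp: lookup_sum lookup_single when_def in_keys_iff sum.delta')

lemma poly_mapping_single_add_induct [case_names single add]:
  fixes f :: "'a \<Rightarrow>\<^sub>0 'b::comm_monoid_add"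
  assumes "\<And>m c. P (Poly_Mapping.single m c)"
    and "\<And>f g. P f \<Longrightarrow> P g \<Longrightarrow> P (f + g)"
  shows "P f"
proof -
  have "P (\<Sum>m\<in>S. Poly_Mapping.single m (Poly_Mapping.lookup f m))" if "finite S" for S
    using that
  proof (induction S)
    case empty
    have "P (Poly_Mapping.single undefined 0)" by (rule assms(1))
    then show ?case by simp
  qed (simp add: assms)
  then show ?thesis using poly_mapping_sum_singles[of f] finite_keys by metis
qed

text \<open>
  The induction principle that belongs to generating the polynomials from the constants and the variables; it hides the
  representation by exponent functions.
\<close>

lemma mpoly_induct [case_names Const add Var_mult]:
  fixes f :: "('i, 'k::field) mpoly"
  assumes C: "\<And>c. P (Const c)"
    and A: "\<And>f g. P f \<Longrightarrow> P g \<Longrightarrow> P (f + g)"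
    and V: "\<And>v f. P f \<Longrightarrow> P (Var v * f)"
  shows "P f"
proof (induction f rule: poly_mapping_single_add_induct)
  case (single m c)
  have "P (g * Poly_Mapping.single m c)" if "\<And>k. P (g * Const k)" for g
    using that
  proof (induction m arbitrary: g c rule: poly_mapping_single_add_induct)
    case (single v n)
    have "P (g * Poly_Mapping.single (0 + Poly_Mapping.single v n) c)"
    proof (induction n)
      case 0
      then show ?case using single[of c] by (simp add: Const_def)
    next
      case (Suc n)
      then show ?case unfolding monomial_eq mult.left_commute[of g] by (rule V)
    qed
    then show ?case by simp
  next
    case (add m1 m2)
    have "P ((g * Poly_Mapping.single m1 1) * Poly_Mapping.single m2 c)"
    proof (rule add.IH(2))
      fix k
      have "P (g * Poly_Mapping.single m1 k)"
        by (rule add.IH(1)) (rule add.prems)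
      then show "P (g * Poly_Mapping.single m1 1 * Const k)"
        by (simp add: Const_def mult_single mult.assoc)
    qed
    then show ?case by (simp add: mult_single mult.assoc)
  qed
  from this[of 1] show ?case using C by simp
qed (rule A)

text \<open>
  Evaluation at \<open>x\<close> with coefficients mapped by \<open>h\<close>. Besides \<^const>\<open>peval\<close> it yields the maps onto polynomials in
  two variables whose kernels are the prime ideals of a chain in the Stanley-Reisner ring.
\<close>

definition insertion :: "('k::field \<Rightarrow> 'b::comm_ring_1) \<Rightarrow> ('i::finite \<Rightarrow> 'b) \<Rightarrow> ('i, 'k) mpoly \<Rightarrow> 'b" where
  "insertion h x f = (\<Sum>m\<in>Poly_Mapping.keys f. h (Poly_Mapping.lookup f m) *
     (\<Prod>i\<in>Poly_Mapping.keys m. x i ^ Poly_Mapping.lookup m i))"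

lemma peval_eq_insertion: "peval c f = insertion id c f"
  by (simp add: peval_def insertion_def)

locale scalar_hom =
  fixes h :: "'k::field \<Rightarrow> 'b::comm_ring_1"
  assumes h_add: "h (a + b) = h a + h b"
    and h_mult: "h (a * b) = h a * h b"
    and h_1: "h 1 = 1"
begin

lemma h_0: "h 0 = 0" using h_add[of 0 0] by simp

lemma insertion_superset:
  fixes x :: "'i::finite \<Rightarrow> 'b"
  assumes "finite S" "Poly_Mapping.keys f \<subseteq> S"
  shows "insertion h x f = (\<Sum>m\<in>S. h (Poly_Mapping.lookup f m) * (\<Prod>i\<in>UNIV. x i ^ Poly_Mapping.lookup m i))"
proof -
  have *: "(\<Prod>i\<in>Poly_Mapping.keys m. x i ^ Poly_Mapping.lookup m i) = (\<Prod>i\<in>UNIV. x i ^ Poly_Mapping.lookup m i)" for m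
    by (rule prod.mono_neutral_left) (auto simp: in_keys_iff)
  show ?thesis unfolding insertion_def *
    by (rule sum.mono_neutral_left) (use assms in \<open>auto simp: in_keys_iff h_0\<close>)
qed

lemma insertion_add: "insertion h x (f + g) = insertion h x f + insertion h x g"
proof -
  let ?S = "Poly_Mapping.keys f \<union> Poly_Mapping.keys g"
  have "finite ?S" "Poly_Mapping.keys (f + g) \<subseteq> ?S" by (auto simp: Poly_Mapping.keys_add)
  then show ?thesis
    by (simp add: insertion_superset[of ?S] lookup_add h_add sum.distrib algebra_simps)
qed

lemma insertion_single: 
  "insertion h x (Poly_Mapping.single m c) = h c * (\<Prod>i\<in>UNIV. x i ^ Poly_Mapping.lookup m i)"
  by (subst insertion_superset[of "{m}"]) auto

lemma insertion_mult: "insertion h x (f * g) = insertion h x f * insertion h x g"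
proof (induction f rule: poly_mapping_single_add_induct)
  case (single m c)
  show ?case
  proof (induction g rule: poly_mapping_single_add_induct)
    case (single m' c')
    show ?case
      by (simp add: mult_single insertion_single h_mult lookup_add power_add prod.distrib)
  qed (simp add: distrib_left insertion_add)
qed (simp add: distrib_right insertion_add)

lemma insertion_Const: "insertion h x (Const c) = h c"
  by (simp add: Const_def insertion_single)

lemma insertion_Var: "insertion h x (Var v) = x v"
proof -
  have "(\<Prod>i\<in>UNIV. x i ^ Poly_Mapping.lookup (Poly_Mapping.single v (1::nat)) i) = (\<Prod>i\<in>UNIV. if i = v then x i else 1)"
    by (rule prod.cong) (auto simp: lookup_single when_def)
  then show ?thesis by (simp add: Var_def insertion_single h_1)
qed

lemma insertion_minus: "insertion h x (- f) = - insertion h x f"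
  using insertion_add[of x f "- f"] insertion_Const[of x 0] 
  by (simp add: h_0 eq_neg_iff_add_eq_0 add.commute)

lemma insertion_diff: "insertion h x (f - g) = insertion h x f - insertion h x g"
  using insertion_add[of x f "- g"] by (simp add: insertion_minus)

lemma insertion_0: "insertion h x 0 = 0"
  using insertion_Const[of x 0] by (simp add: h_0)

lemma insertion_1: "insertion h x 1 = 1"
  using insertion_Const[of x 1] by (simp add: h_1)

lemma insertion_sum: "insertion h x (\<Sum>a\<in>A. f a) = (\<Sum>a\<in>A. insertion h x (f a))"
  by (induction A rule: infinite_finite_induct) (simp_all add: insertion_0 insertion_add)

lemma insertion_prod: "insertion h x (\<Prod>a\<in>A. f a) = (\<Prod>a\<in>A. insertion h x (f a))"
  by (induction A rule: infinite_finite_induct) (simp_all add: insertion_1 insertion_mult)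

lemmas insertion_simps = insertion_add insertion_mult insertion_Const insertion_Var insertion_minus
  insertion_diff insertion_0 insertion_1 insertion_sum insertion_prod

end

definition mdeg :: "('i \<Rightarrow>\<^sub>0 nat) \<Rightarrow> nat" where
  "mdeg m = (\<Sum>i\<in>Poly_Mapping.keys m. Poly_Mapping.lookup m i)"

lemma mdeg_UNIV: "mdeg m = (\<Sum>i\<in>UNIV. Poly_Mapping.lookup m i)" for m :: "'i::finite \<Rightarrow>\<^sub>0 nat"
  unfolding mdeg_def by (rule sum.mono_neutral_left) (auto simp: in_keys_iff)

lemma mdeg_add: "mdeg (m + m') = mdeg m + mdeg m'" for m :: "'i::finite \<Rightarrow>\<^sub>0 nat"
  by (simp add: mdeg_UNIV lookup_add sum.distrib)

lemma mdeg_single [simp]: "mdeg (Poly_Mapping.single v n) = n"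
  by (cases "n = 0") (simp_all add: mdeg_def)

lemma mdeg_eq_0_iff: "mdeg m = 0 \<longleftrightarrow> m = 0"
  by (auto simp: mdeg_def in_keys_iff) (metis keys_eq_empty poly_mapping_eqI lookup_zero in_keys_iff)

lemma homogeneous_mdeg: "homogeneous d f \<longleftrightarrow> (\<forall>m\<in>Poly_Mapping.keys f. mdeg m = d)"
  by (simp add: homogeneous_def mdeg_def)

lemma homogeneous_add: "homogeneous d f \<Longrightarrow> homogeneous d g \<Longrightarrow> homogeneous d (f + g)"
  using Poly_Mapping.keys_add[of f g] by (auto simp: homogeneous_mdeg)

lemma homogeneous_0 [simp]: "homogeneous d 0" by (simp add: homogeneous_mdeg)

lemma homogeneous_sum: "(\<And>a. a \<in> A \<Longrightarrow> homogeneous d (f a)) \<Longrightarrow> homogeneous d (\<Sum>a\<in>A. f a)"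
  by (induction A rule: infinite_finite_induct) (auto intro: homogeneous_add)

lemma homogeneous_mult: "homogeneous d f \<Longrightarrow> homogeneous e g \<Longrightarrow> homogeneous (d + e) (f * g)"
  for f :: "('i::finite, 'k::field) mpoly"
  using Poly_Mapping.keys_mult[of f g] by (fastforce simp: homogeneous_mdeg mdeg_add)

lemma homogeneous_Var: "homogeneous 1 (Var v)" by (simp add: homogeneous_mdeg Var_def)
lemma homogeneous_Const: "homogeneous 0 (Const c)" by (simp add: homogeneous_mdeg Const_def mdeg_def)

lemma homogeneous_linear_form: "homogeneous 1 (linear_form a)"
  unfolding linear_form_def
  using homogeneous_mult[OF homogeneous_Const homogeneous_Var] by (intro homogeneous_sum) auto

lemma mdeg_2E:
  fixes m :: "'i::finite \<Rightarrow>\<^sub>0 nat"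
  assumes "mdeg m = 2"
  obtains u v where "m = Poly_Mapping.single u 1 + Poly_Mapping.single v 1"
proof -
  have split: "\<exists>u m'. m = Poly_Mapping.single u 1 + m'" if "mdeg m > 0" for m :: "'i \<Rightarrow>\<^sub>0 nat"
  proof -
    have "\<exists>u. Poly_Mapping.lookup m u \<noteq> 0"
    proof (rule ccontr)
      assume "\<nexists>u. Poly_Mapping.lookup m u \<noteq> 0"
      then have "mdeg m = 0" by (simp add: mdeg_UNIV)
      with that show False by simp
    qed
    then obtain u where "Poly_Mapping.lookup m u > 0" by auto
    then have "m = Poly_Mapping.single u 1 + (m - Poly_Mapping.single u 1)"
      by (intro poly_mapping_eqI) (auto simp: lookup_add lookup_minus lookup_single when_def)
    then show ?thesis by blast
  qed
  obtain u m' where 1: "m = Poly_Mapping.single u 1 + m'" using split[of m] assms by auto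
  then have "mdeg m' = 1" using assms by (simp add: mdeg_add)
  then obtain v m'' where 2: "m' = Poly_Mapping.single v 1 + m''" using split[of m'] by auto
  then have "m'' = 0" using \<open>mdeg m' = 1\<close> by (simp add: mdeg_add mdeg_eq_0_iff)
  then show thesis using 1 2 that by simp
qed

text \<open>
  The coefficients of a product at exponents of degree at most two without squares; they serve to describe ideals by
  conditions on low coefficients.
\<close>

lemma lookup_mult_0:
  fixes f :: "('i::finite, 'k::field) mpoly"
  shows "Poly_Mapping.lookup (f * g) 0 = Poly_Mapping.lookup f 0 * Poly_Mapping.lookup g 0"
proof (induction f rule: poly_mapping_single_add_induct)
  case (single m c)
  show ?case
  proof (induction g rule: poly_mapping_single_add_induct)
    case (single m' c')
    have "m + m' = 0 \<longleftrightarrow> m = 0 \<and> m' = 0" by (simp add: mdeg_add flip: mdeg_eq_0_iff)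
    then show ?case by (auto simp: mult_single lookup_single when_def)
  qed (simp add: distrib_left lookup_add)
qed (simp add: distrib_right lookup_add)

definition uexp :: "'i \<Rightarrow> ('i \<Rightarrow>\<^sub>0 nat)" where
  "uexp i = Poly_Mapping.single i 1"

lemma lookup_uexp: "Poly_Mapping.lookup (uexp i) k = (if k = i then 1 else 0)"
  by (simp add: uexp_def lookup_single when_def)

lemma mdeg_uexp [simp]: "mdeg (uexp i) = 1"
  by (simp add: uexp_def)

lemma uexp_neq_0 [simp]: "uexp i \<noteq> 0" "0 \<noteq> uexp i"
  using mdeg_eq_0_iff[of "uexp i"] by auto

lemma uexp_inj [simp]: "uexp i = uexp j \<longleftrightarrow> i = j"
  by (metis lookup_uexp zero_neq_one)

lemma Var_uexp: "Var i = Poly_Mapping.single (uexp i) 1"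
  by (simp add: Var_def uexp_def)

lemma add_eq_uexp_iff:
  fixes m m' :: "'i::finite \<Rightarrow>\<^sub>0 nat"
  shows "m + m' = uexp i \<longleftrightarrow> m = 0 \<and> m' = uexp i \<or> m = uexp i \<and> m' = 0"
proof
  assume eq: "m + m' = uexp i"
  then have "mdeg m + mdeg m' = 1" by (metis mdeg_add mdeg_uexp)
  then consider "mdeg m = 0" | "mdeg m' = 0" by linarith
  then show "m = 0 \<and> m' = uexp i \<or> m = uexp i \<and> m' = 0"
    using eq by cases (auto simp: mdeg_eq_0_iff)
qed auto

lemma lookup_mult_1:
  fixes f :: "('i::finite, 'k::field) mpoly"
  shows "Poly_Mapping.lookup (f * g) (uexp i) =
     Poly_Mapping.lookup f 0 * Poly_Mapping.lookup g (uexp i) +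
     Poly_Mapping.lookup f (uexp i) * Poly_Mapping.lookup g 0"
proof (induction f rule: poly_mapping_single_add_induct)
  case (single m c)
  show ?case
  proof (induction g rule: poly_mapping_single_add_induct)
    case (single m' c')
    show ?case
      by (auto simp: mult_single lookup_single when_def add_eq_uexp_iff)
  qed (simp add: distrib_left lookup_add algebra_simps)
qed (simp add: distrib_right lookup_add algebra_simps)

lemma add_eq_uexp_uexp_iff:
  fixes m m' :: "'i::finite \<Rightarrow>\<^sub>0 nat"
  assumes "i \<noteq> j"
  shows "m + m' = uexp i + uexp j \<longleftrightarrow>
     m = 0 \<and> m' = uexp i + uexp j \<or> m = uexp i \<and> m' = uexp j \<or>
     m = uexp j \<and> m' = uexp i \<or> m = uexp i + uexp j \<and> m' = 0"
proof
  assume eq: "m + m' = uexp i + uexp j"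
  have "Poly_Mapping.lookup (m + m') k = (if k = i \<or> k = j then 1 else 0)" for k
    using assms by (simp add: eq lookup_add lookup_uexp)
  then have "Poly_Mapping.lookup m k + Poly_Mapping.lookup m' k = (if k = i \<or> k = j then 1 else 0)" for k
    by (simp add: lookup_add)
  then have le: "Poly_Mapping.lookup m k \<le> (if k = i \<or> k = j then 1 else 0)" for k
    by (metis le_add1)
  have "m = (if Poly_Mapping.lookup m i = 0 then 0 else uexp i) + (if Poly_Mapping.lookup m j = 0 then 0 else uexp j)"
  proof (rule poly_mapping_eqI)
    fix k show "Poly_Mapping.lookup m k = Poly_Mapping.lookup ((if Poly_Mapping.lookup m i = 0 then 0 else uexp i) + (if Poly_Mapping.lookup m j = 0 then 0 else uexp j)) k"
      using le[of k] assms by (auto simp: lookup_add lookup_uexp split: if_splits)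
  qed
  then obtain a b where "m = (if a then 0 else uexp i) + (if b then 0 else uexp j)"
    by blast
  then consider "m = 0" | "m = uexp i" | "m = uexp j" | "m = uexp i + uexp j" 
    by (cases a; cases b) auto
  then show "m = 0 \<and> m' = uexp i + uexp j \<or> m = uexp i \<and> m' = uexp j \<or> m = uexp j \<and> m' = uexp i \<or> m = uexp i + uexp j \<and> m' = 0"
    using eq by cases (auto simp: add.commute[of "uexp j"])
qed (auto simp: add_ac)

lemma lookup_mult_2:
  fixes f :: "('i::finite, 'k::field) mpoly"
  assumes ij: "i \<noteq> j"
  shows "Poly_Mapping.lookup (f * g) (uexp i + uexp j) =
     Poly_Mapping.lookup f 0 * Poly_Mapping.lookup g (uexp i + uexp j) +
     Poly_Mapping.lookup f (uexp i) * Poly_Mapping.lookup g (uexp j) +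
     Poly_Mapping.lookup f (uexp j) * Poly_Mapping.lookup g (uexp i) +
     Poly_Mapping.lookup f (uexp i + uexp j) * Poly_Mapping.lookup g 0"
proof (induction f rule: poly_mapping_single_add_induct)
  case (single m c)
  define e where "e = uexp i + uexp j"
  have ne: "uexp i \<noteq> uexp j" "uexp i \<noteq> 0" "uexp j \<noteq> 0" "e \<noteq> 0" "e \<noteq> uexp i" "e \<noteq> uexp j"
    using ij by (auto simp: e_def mdeg_add simp flip: mdeg_eq_0_iff dest!: arg_cong[where f = mdeg])
  show ?case
  proof (induction g rule: poly_mapping_single_add_induct)
    case (single m' c')
    note iff = add_eq_uexp_uexp_iff[OF ij, of m m', folded e_def]
    have "Poly_Mapping.lookup (Poly_Mapping.single m c * Poly_Mapping.single m' c') e = (c * c' when m + m' = e)"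
      by (simp add: mult_single lookup_single)
    also have "\<dots> = (c when m = 0) * (c' when m' = e) + (c when m = uexp i) * (c' when m' = uexp j) +
       (c when m = uexp j) * (c' when m' = uexp i) + (c when m = e) * (c' when m' = 0)"
      unfolding iff using ne ne[symmetric] by (auto simp: when_def )
    finally show ?case unfolding e_def by (simp add: lookup_single)
  qed (simp add: distrib_left lookup_add algebra_simps)
qed (simp add: distrib_right lookup_add algebra_simps)


section \<open>Ideals and the quotients of the Stanley-Reisner ring\<close>

lemma type_ring_simps [simp]:
  "carrier (ring_of_type_algebra :: 'a::ring_1 ring) = UNIV"
  "x \<otimes>\<^bsub>ring_of_type_algebra\<^esub> y = x * (y :: 'a)"
  "x \<oplus>\<^bsub>ring_of_type_algebra\<^esub> y = x + (y :: 'a)"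
  "\<zero>\<^bsub>ring_of_type_algebra\<^esub> = (0 :: 'a)"
  "\<one>\<^bsub>ring_of_type_algebra\<^esub> = (1 :: 'a)"
  by (simp_all add: ring_of_type_algebra_def)

lemma type_ring_uminus [simp]: "\<ominus>\<^bsub>ring_of_type_algebra\<^esub> x = - (x :: 'a::comm_ring_1)"
proof -
  interpret ring "ring_of_type_algebra :: 'a ring" by (rule ring_from_type_algebra)
  show ?thesis using minus_equality[of "- x" x] by simp
qed

text \<open>
  With this translation all membership questions are treated as statements about sets in a type of class
  \<^class>\<open>comm_ring_1\<close>, without carriers.
\<close>

lemma ideal_type_ring_iff:
  "ideal J (ring_of_type_algebra :: 'a::comm_ring_1 ring) \<longleftrightarrow>
     0 \<in> J \<and> (\<forall>f\<in>J. \<forall>g\<in>J. f + g \<in> J) \<and> (\<forall>f\<in>J. \<forall>g. g * f \<in> J)"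
proof
  assume "ideal J (ring_of_type_algebra :: 'a ring)"
  then interpret ideal J "ring_of_type_algebra :: 'a ring" .
  show "0 \<in> J \<and> (\<forall>f\<in>J. \<forall>g\<in>J. f + g \<in> J) \<and> (\<forall>f\<in>J. \<forall>g. g * f \<in> J)"
    using additive_subgroup.zero_closed[OF is_additive_subgroup]
      additive_subgroup.a_closed[OF is_additive_subgroup] I_l_closed by auto
next
  assume J: "0 \<in> J \<and> (\<forall>f\<in>J. \<forall>g\<in>J. f + g \<in> J) \<and> (\<forall>f\<in>J. \<forall>g. g * f \<in> J)"
  interpret ring "ring_of_type_algebra :: 'a ring" by (rule ring_from_type_algebra)
  have minus: "- f \<in> J" if "f \<in> J" for f
    using J that by (metis mult_minus1)
  have "subgroup J (add_monoid (ring_of_type_algebra :: 'a ring))"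
    by (rule add.subgroupI) (use J minus in auto)
  then show "ideal J (ring_of_type_algebra :: 'a ring)"
    by (intro idealI ring_axioms) (use J in \<open>auto simp: mult.commute\<close>)
qed

lemma (in ideal) FactRing_carrier: "carrier (R Quot I) = (+>) I ` carrier R"
  by (auto simp: FactRing_simps)

lemma (in ideal) coset_eq_zero_iff: "x \<in> carrier R \<Longrightarrow> I +> x = \<zero>\<^bsub>R Quot I\<^esub> \<longleftrightarrow> x \<in> I"
  using rcos_const_imp_mem a_rcos_zero[OF ideal_axioms] by (auto simp: FactRing_def)


definition SR_gens :: "'v set set \<Rightarrow> ('v, 'k::field) mpoly set" where
  "SR_gens E = {Var i * Var j | i j. i \<noteq> j \<and> {i, j} \<notin> E} \<union>
      {Var i * Var j * Var m | i j m. i \<noteq> j \<and> i \<noteq> m \<and> j \<noteq> m}"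

text \<open>
  The two successive quotients are replaced by one ideal of the polynomial ring, the kernel of the composite map.
\<close>

definition SR_quot_kernel :: "'v set set \<Rightarrow> ('v, 'k::field) mpoly set \<Rightarrow> ('v, 'k) mpoly set" where
  "SR_quot_kernel E L = {f. SR_quot_class E L f = \<zero>\<^bsub>SR_quot E L\<^esub>}"

lemma cring_mpoly_ring: "cring (mpoly_ring :: ('v, 'k::field) mpoly ring)"
  by (rule cring_from_type_algebra)

lemma SR_ideal_gens: "SR_ideal E = Idl\<^bsub>mpoly_ring\<^esub> (SR_gens E)"
  by (simp add: SR_ideal_def SR_gens_def)

lemma ideal_SR_ideal: "ideal (SR_ideal E) (mpoly_ring :: ('v, 'k::field) mpoly ring)"
  unfolding SR_ideal_gens
  by (rule ring.genideal_ideal[OF cring.axioms(1)[OF cring_mpoly_ring]]) simp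

lemma SR_gens_subset: "SR_gens E \<subseteq> (SR_ideal E :: ('v, 'k::field) mpoly set)"
  unfolding SR_ideal_gens
  by (rule ring.genideal_self[OF cring.axioms(1)[OF cring_mpoly_ring]]) simp

lemma SR_ideal_minimal:
  "ideal M (mpoly_ring :: ('v, 'k::field) mpoly ring) \<Longrightarrow> SR_gens E \<subseteq> M \<Longrightarrow> SR_ideal E \<subseteq> M"
  unfolding SR_ideal_gens
  by (rule ring.genideal_minimal[OF cring.axioms(1)[OF cring_mpoly_ring]])

lemma SR_ring_presentation:
  fixes E :: "'v set set"
  defines "S \<equiv> SR_ring E :: ('v, 'k::field) mpoly set ring"
  shows "cring S" "SR_class E \<in> ring_hom mpoly_ring S" "carrier S = range (SR_class E)"
    "SR_class E f = \<zero>\<^bsub>S\<^esub> \<longleftrightarrow> f \<in> SR_ideal E"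
proof -
  interpret ideal "SR_ideal E" "mpoly_ring :: ('v, 'k) mpoly ring" by (rule ideal_SR_ideal)
  show "cring S" unfolding S_def SR_ring_def by (rule quotient_is_cring[OF cring_mpoly_ring])
  have cl: "SR_class E = (+>\<^bsub>mpoly_ring\<^esub>) (SR_ideal E)" by (rule ext) (simp add: SR_class_def)
  show "SR_class E \<in> ring_hom mpoly_ring S" 
    unfolding S_def SR_ring_def cl by (rule rcos_ring_hom)
  show "carrier S = range (SR_class E)"
    unfolding S_def SR_ring_def cl using FactRing_carrier by simp
  show "SR_class E f = \<zero>\<^bsub>S\<^esub> \<longleftrightarrow> f \<in> SR_ideal E"
    unfolding S_def SR_ring_def cl using coset_eq_zero_iff by simp
qed

lemma SR_quot_presentation:
  fixes E :: "'v set set" and L :: "('v, 'k::field) mpoly set"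
  shows "cring (SR_quot E L)" "SR_quot_class E L \<in> ring_hom mpoly_ring (SR_quot E L)"
    "carrier (SR_quot E L) = range (SR_quot_class E L)"
    "SR_quot_class E L f = \<zero>\<^bsub>SR_quot E L\<^esub> \<longleftrightarrow> SR_class E f \<in> SR_quot_ideal E L"
    "ideal (SR_quot_ideal E L) (SR_ring E)"
proof -
  let ?S = "SR_ring E :: ('v, 'k) mpoly set ring"
  note S = SR_ring_presentation[of E, where 'k = 'k]
  show *: "ideal (SR_quot_ideal E L) ?S" unfolding SR_quot_ideal_def
    by (rule ring.genideal_ideal[OF cring.axioms(1)[OF S(1)]]) (use S(3) in auto)
  then interpret ideal "SR_quot_ideal E L" ?S .
  show "cring (SR_quot E L)" unfolding SR_quot_def by (rule quotient_is_cring[OF S(1)])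
  have cl: "SR_quot_class E L = (+>\<^bsub>?S\<^esub>) (SR_quot_ideal E L) \<circ> SR_class E"
    by (rule ext) (simp add: SR_quot_class_def)
  show "SR_quot_class E L \<in> ring_hom mpoly_ring (SR_quot E L)" 
    unfolding cl SR_quot_def by (rule ring_hom_trans[OF S(2) rcos_ring_hom])
  show "carrier (SR_quot E L) = range (SR_quot_class E L)"
    unfolding SR_quot_def FactRing_carrier cl S(3) by (simp add: image_comp)
  show "SR_quot_class E L f = \<zero>\<^bsub>SR_quot E L\<^esub> \<longleftrightarrow> SR_class E f \<in> SR_quot_ideal E L"
    unfolding SR_quot_def cl using coset_eq_zero_iff[of "SR_class E f"] S(3) by auto
qed

lemma SR_quot_class_simps:
  "SR_quot_class E L f \<in> carrier (SR_quot E L)"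
  "SR_quot_class E L f \<otimes>\<^bsub>SR_quot E L\<^esub> SR_quot_class E L g = SR_quot_class E L (f * g)"
  "SR_quot_class E L f \<oplus>\<^bsub>SR_quot E L\<^esub> SR_quot_class E L g = SR_quot_class E L (f + g)"
  "\<one>\<^bsub>SR_quot E L\<^esub> = SR_quot_class E L 1"
  using SR_quot_presentation(2)[of E L] by (auto simp: ring_hom_def)

lemma SR_quot_class_eq_iff:
  "SR_quot_class E L f = SR_quot_class E L g \<longleftrightarrow> f - g \<in> SR_quot_kernel E L"
proof -
  let ?R = "SR_quot E L"
  interpret R: cring ?R by (rule SR_quot_presentation)
  have "SR_quot_class E L f = SR_quot_class E L (f - g) \<oplus>\<^bsub>?R\<^esub> SR_quot_class E L g"
    by (simp add: SR_quot_class_simps)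
  moreover have "x \<oplus>\<^bsub>?R\<^esub> y = y \<longleftrightarrow> x = \<zero>\<^bsub>?R\<^esub>" if "x \<in> carrier ?R" "y \<in> carrier ?R" for x y
    using that R.add.r_cancel_one by simp
  ultimately show ?thesis using SR_quot_class_simps(1)[of E L]
    by (simp add: SR_quot_kernel_def)
qed

lemma ideal_SR_quot_kernel: "ideal (SR_quot_kernel E L) (mpoly_ring :: ('v, 'k::field) mpoly ring)"
proof -
  interpret R: cring "SR_quot E L" by (rule SR_quot_presentation)
  have "SR_quot_class E L 0 = \<zero>\<^bsub>SR_quot E L\<^esub>"
    using SR_quot_class_simps(3)[of E L 0 0] SR_quot_class_simps(1)[of E L 0] R.add.l_cancel_one' 
    by simp
  then show ?thesis
    unfolding ideal_type_ring_iff SR_quot_kernel_def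
    by (auto simp flip: SR_quot_class_simps simp: SR_quot_class_simps(1))
qed

lemma SR_gens_subset_kernel:
  fixes L :: "('v, 'k::field) mpoly set"
  shows "SR_gens E \<subseteq> SR_quot_kernel E L"
proof
  fix f :: "('v, 'k) mpoly" assume "f \<in> SR_gens E"
  then have "SR_class E f = \<zero>\<^bsub>SR_ring E\<^esub>" using SR_gens_subset SR_ring_presentation(4) by blast
  then show "f \<in> SR_quot_kernel E L"
    using SR_quot_presentation(4,5) additive_subgroup.zero_closed[OF ideal.axioms(1)]
    unfolding SR_quot_kernel_def by (metis (mono_tags, lifting) mem_Collect_eq)
qed

lemma subset_SR_quot_kernel: "L \<subseteq> SR_quot_kernel E L"
proof -
  have "SR_class E ` L \<subseteq> SR_quot_ideal E L"
    unfolding SR_quot_ideal_def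
    by (rule ring.genideal_self[OF cring.axioms(1)[OF SR_ring_presentation(1)]]) (auto simp: SR_ring_presentation(3))
  then show ?thesis by (auto simp: SR_quot_kernel_def SR_quot_presentation(4))
qed

lemma SR_class_image_ideal:
  fixes M :: "('v, 'k::field) mpoly set"
  assumes M: "ideal M mpoly_ring" and "SR_gens E \<subseteq> M"
  shows "ideal (SR_class E ` M) (SR_ring E)" "SR_class E f \<in> SR_class E ` M \<longleftrightarrow> f \<in> M"
proof -
  let ?S = "SR_ring E :: ('v, 'k) mpoly set ring"
  note S = SR_ring_presentation[of E, where 'k = 'k]
  interpret S: cring ?S by (rule S(1))
  have cl: "SR_class E f \<oplus>\<^bsub>?S\<^esub> SR_class E g = SR_class E (f + g)"
     "SR_class E f \<otimes>\<^bsub>?S\<^esub> SR_class E g = SR_class E (f * g)" for f g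
    using S(2) by (auto simp: ring_hom_def)
  note M' = M[unfolded ideal_type_ring_iff]
  have "SR_ideal E \<subseteq> M" by (rule SR_ideal_minimal) fact+
  have minus: "- f \<in> M" if "f \<in> M" for f using M' that by (metis mult_minus1)
  show "SR_class E f \<in> SR_class E ` M \<longleftrightarrow> f \<in> M"
  proof
    assume "SR_class E f \<in> SR_class E ` M"
    then obtain g where g: "g \<in> M" "SR_class E f = SR_class E g" by auto
    have "SR_class E (f - g) \<oplus>\<^bsub>?S\<^esub> SR_class E g = SR_class E g" using g(2) by (simp add: cl)
    then have "SR_class E (f - g) = \<zero>\<^bsub>?S\<^esub>" using S(3) S.add.r_cancel_one by (metis rangeI)
    then have "f - g \<in> M" using \<open>SR_ideal E \<subseteq> M\<close> S(4) by auto
    then show "f \<in> M" using M' g(1) by (metis diff_add_cancel)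
  qed simp
  show "ideal (SR_class E ` M) ?S"
  proof (rule idealI[OF S.ring_axioms])
    show "subgroup (SR_class E ` M) (add_monoid ?S)"
    proof (rule S.add.subgroupI)
      fix a assume "a \<in> SR_class E ` M"
      then obtain f where f: "f \<in> M" "a = SR_class E f" by auto
      have "SR_class E (- f) \<oplus>\<^bsub>?S\<^esub> a = SR_class E 0" by (simp add: f cl)
      also have "SR_class E 0 = \<zero>\<^bsub>?S\<^esub>"
        using S(4) additive_subgroup.zero_closed[OF ideal.axioms(1)[OF ideal_SR_ideal[of E, where 'k = 'k]]]
        by auto
      finally have "\<ominus>\<^bsub>?S\<^esub> a = SR_class E (- f)" by (rule S.minus_equality) (use f S(3) in auto)
      then show "\<ominus>\<^bsub>?S\<^esub> a \<in> SR_class E ` M"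
        using minus[OF f(1)] by (metis imageI)
    qed (use M' S(3) in \<open>auto simp: cl\<close>)
  qed (use M' S(3) in \<open>auto simp: cl mult.commute\<close>)
qed

text \<open>
  The kernel is generated by the monomials of \<^const>\<open>SR_gens\<close> together with \<open>L\<close>, so that any ideal given by other means
  yields necessary conditions for membership.
\<close>

lemma SR_quot_kernel_minimal:
  fixes M :: "('v, 'k::field) mpoly set"
  assumes M: "ideal M mpoly_ring" "SR_gens E \<subseteq> M" and "L \<subseteq> M"
  shows "SR_quot_kernel E L \<subseteq> M"
proof
  have "SR_class E ` L \<subseteq> SR_class E ` M" using assms(3) by auto
  then have "SR_quot_ideal E L \<subseteq> SR_class E ` M"
    unfolding SR_quot_ideal_def
    using ring.genideal_minimal[OF cring.axioms(1)[OF SR_ring_presentation(1)]] SR_class_image_ideal(1)[OF M]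
    by blast
  moreover fix f assume "f \<in> SR_quot_kernel E L"
  ultimately have "SR_class E f \<in> SR_class E ` M" by (auto simp: SR_quot_kernel_def SR_quot_presentation(4))
  then show "f \<in> M" by (simp add: SR_class_image_ideal(2)[OF M])
qed

lemma subfield_SR_quot_Const:
  assumes "1 \<notin> SR_quot_kernel E L"
  shows "subfield (SR_quot_class E L ` range Const) (SR_quot E L)"
proof -
  interpret K: field "ring_of_type_algebra :: 'b::field ring" by (rule field_from_type_algebra)
  interpret R: cring "SR_quot E L" by (rule SR_quot_presentation)
  interpret H: ring_hom_ring "ring_of_type_algebra :: 'b ring" "SR_quot E L" "\<lambda>k. SR_quot_class E L (Const k)"
    by (intro ring_hom_ringI2 K.ring_axioms R.ring_axioms ring_hom_memI)
       (auto simp: SR_quot_class_simps Const_hom)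
  have "\<one>\<^bsub>SR_quot E L\<^esub> \<noteq> \<zero>\<^bsub>SR_quot E L\<^esub>"
    using assms by (simp add: SR_quot_kernel_def SR_quot_class_simps)
  then have "subfield ((\<lambda>k. SR_quot_class E L (Const k)) ` UNIV) (SR_quot E L)"
    using H.img_is_subfield(2)[OF K.carrier_is_subfield] by simp
  then show ?thesis by (simp add: image_comp comp_def)
qed


section \<open>The Krull dimension of the Stanley-Reisner ring\<close>

text \<open>
  By Gaussian elimination: each step of the induction removes one equation and one unknown.
\<close>

lemma underdetermined_linear_system:
  fixes v :: "'t \<Rightarrow> 'x \<Rightarrow> 'k::field"
  assumes "finite Y" "finite T" "card Y < card T"
  shows "\<exists>c. (\<exists>t\<in>T. c t \<noteq> 0) \<and> (\<forall>x\<in>Y. (\<Sum>t\<in>T. c t * v t x) = 0)"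
  using assms
proof (induction Y arbitrary: T v)
  case empty
  then obtain t where "t \<in> T" by fastforce
  then show ?case by (intro exI[of _ "\<lambda>_. 1"]) auto
next
  case (insert x Y)
  show ?case
  proof (cases "\<forall>t\<in>T. v t x = 0")
    case True
    have "card Y < card T" using insert by simp
    from insert.IH[OF insert.prems(1) this, of v] show ?thesis using True by auto
  next
    case False
    then obtain s where s: "s \<in> T" "v s x \<noteq> 0" by auto
    let ?T = "T - {s}"
    have "card Y < card ?T" using insert s by simp
    from insert.IH[OF _ this, of "\<lambda>t y. v t y - v t x / v s x * v s y"] insert.prems(1)
    obtain c where c: "\<exists>t\<in>?T. c t \<noteq> 0"
      "\<forall>y\<in>Y. (\<Sum>t\<in>?T. c t * (v t y - v t x / v s x * v s y)) = 0" by auto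
    define q where "q = - (\<Sum>t\<in>?T. c t * v t x) / v s x"
    have eq: "(\<Sum>t\<in>T. (c(s := q)) t * v t y) = (\<Sum>t\<in>?T. c t * (v t y - v t x / v s x * v s y))" for y
    proof -
      have "(\<Sum>t\<in>T. (c(s := q)) t * v t y) = q * v s y + (\<Sum>t\<in>?T. c t * v t y)"
        using insert.prems(1) s by (subst sum.remove[of _ s]) (auto intro!: sum.cong)
      also have "q * v s y = - (\<Sum>t\<in>?T. c t * (v t x / v s x * v s y))"
        by (simp add: q_def sum_distrib_right sum_divide_distrib mult.assoc)
      finally show ?thesis by (simp add: algebra_simps sum_subtractf)
    qed
    have "(\<Sum>t\<in>?T. c t * (v t x - v t x / v s x * v s x)) = 0" using s by simp
    then have "\<forall>y\<in>insert x Y. (\<Sum>t\<in>T. (c(s := q)) t * v t y) = 0" using c(2) unfolding eq by blast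
    moreover have "\<exists>t\<in>T. (c(s := q)) t \<noteq> 0" using c(1) by auto
    ultimately show ?thesis by blast
  qed
qed

text \<open>
  A relation in the powers of \<open>f\<close> modulo \<open>P\<close> has its constant term in \<open>Q\<close>; when that term is known to vanish, \<open>f\<close> can
  be cancelled, since \<open>P\<close> is prime, and the next coefficient becomes the constant term. The last hypothesis is the form in
  which this step is iterated along a chain of primes.
\<close>

lemma power_sum_mem_prime:
  fixes f :: "'a::comm_ring_1"
  assumes P: "primeideal P ring_of_type_algebra" and Q: "ideal Q ring_of_type_algebra"
    and "P \<subseteq> Q" "f \<in> Q" "f \<notin> P"
    and "(\<Sum>a<N. g a * f ^ a) \<in> P"
    and "\<And>a. a < N \<Longrightarrow> g a \<in> Q \<Longrightarrow> g a = 0"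
  shows "\<forall>a<N. g a = 0"
  using assms(6,7)
proof (induction N arbitrary: g)
  case (Suc N)
  interpret P: primeideal P "ring_of_type_algebra :: 'a ring" by (rule P)
  note Q' = Q[unfolded ideal_type_ring_iff]
  let ?s = "\<Sum>a<N. g (Suc a) * f ^ a"
  have eq: "(\<Sum>a<Suc N. g a * f ^ a) = g 0 + ?s * f"
    by (subst sum.lessThan_Suc_shift) (simp add: sum_distrib_left sum_distrib_right mult_ac)
  have "g 0 + ?s * f \<in> Q" using Suc.prems(1) assms(3) unfolding eq by blast
  moreover have "(-1) * (?s * f) \<in> Q" using Q' assms(4) by blast
  ultimately have "(g 0 + ?s * f) + (-1) * (?s * f) \<in> Q" using Q' by blast
  then have "g 0 = 0" using Suc.prems(2)[of 0] by simp
  then have "?s * f \<in> P" using Suc.prems(1) unfolding eq by simp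
  then have "?s \<in> P" using P.I_prime[of ?s f] assms(5) by simp
  then have "\<forall>a<N. g (Suc a) = 0" by (rule Suc.IH) (use Suc.prems(2) in auto)
  then show ?case using \<open>g 0 = 0\<close> less_Suc_eq_0_disj by auto
qed simp

lemma prime_Const_mem:
  assumes "primeideal P (mpoly_ring :: ('i, 'k::field) mpoly ring)" "Const k \<in> P"
  shows "k = 0"
proof (rule ccontr)
  assume k: "k \<noteq> 0"
  interpret primeideal P "mpoly_ring :: ('i, 'k) mpoly ring" by (rule assms(1))
  have "f \<in> P" for f
  proof -
    have "(f * Const (inverse k)) * Const k \<in> P" 
      using assms(2) is_ideal unfolding ideal_type_ring_iff by blast
    moreover have "(f * Const (inverse k)) * Const k = f" 
      using k by (simp add: mult.assoc flip: Const_mult)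
    ultimately show ?thesis by simp
  qed
  then show False using I_notcarr by auto
qed

text \<open>
  A vanishing combination of monomials in \<open>f1, f2, f3\<close> modulo \<open>P0\<close> is read as a polynomial in \<open>f1\<close> whose coefficients are
  polynomials in \<open>f2\<close> and so on, and the coefficients are removed one level at a time.
\<close>

lemma prime_chain_algebraically_independent:
  fixes k :: "nat \<Rightarrow> nat \<Rightarrow> nat \<Rightarrow> 'k::field" and f1 f2 f3 :: "('i, 'k) mpoly"
  assumes P: "primeideal P0 mpoly_ring" "primeideal P1 mpoly_ring"
      "primeideal P2 mpoly_ring" "primeideal P3 mpoly_ring"
    and sub: "P0 \<subseteq> P1" "P1 \<subseteq> P2" "P2 \<subseteq> P3"
    and f: "f1 \<in> P1 - P0" "f2 \<in> P2 - P1" "f3 \<in> P3 - P2"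
    and mem: "(\<Sum>a<N. \<Sum>b<N. \<Sum>c<N. Const (k a b c) * (f1 ^ a * (f2 ^ b * f3 ^ c))) \<in> P0"
  shows "\<forall>a<N. \<forall>b<N. \<forall>c<N. k a b c = 0"
proof -
  note ideals = primeideal.axioms(1)[OF P(2)] primeideal.axioms(1)[OF P(3)] primeideal.axioms(1)[OF P(4)]
  define g3 where "g3 a b = (\<Sum>c<N. Const (k a b c) * f3 ^ c)" for a b
  define g2 where "g2 a = (\<Sum>b<N. g3 a b * f2 ^ b)" for a
  have 3: "\<forall>c<N. k a b c = 0" if "g3 a b \<in> P2" for a b
  proof -
    have "\<forall>c<N. Const (k a b c) = (0 :: ('i, 'k) mpoly)"
      by (rule power_sum_mem_prime[OF P(3) ideals(3) sub(3)])
         (use f(3) that in \<open>auto simp: g3_def dest: prime_Const_mem[OF P(4)]\<close>)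
    moreover have "Const x = (0 :: ('i, 'k) mpoly) \<Longrightarrow> x = 0" for x :: 'k
      by (metis Const_def lookup_single_eq lookup_zero)
    ultimately show ?thesis by blast
  qed
  then have 3: "\<forall>c<N. k a b c = 0" "g3 a b = 0" if "g3 a b \<in> P2" for a b
    using that by (auto simp: g3_def)
  have 2: "\<forall>b<N. g3 a b = 0" if "g2 a \<in> P1" for a
    by (rule power_sum_mem_prime[OF P(2) ideals(2) sub(2)])
       (use f(2) that 3 in \<open>auto simp: g2_def\<close>)
  then have 2: "\<forall>b<N. g3 a b = 0" "g2 a = 0" if "g2 a \<in> P1" for a
    using that by (auto simp: g2_def)
  have "(\<Sum>a<N. g2 a * f1 ^ a) = (\<Sum>a<N. \<Sum>b<N. \<Sum>c<N. Const (k a b c) * (f1 ^ a * (f2 ^ b * f3 ^ c)))"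
    by (simp add: g2_def g3_def sum_distrib_right sum_distrib_left mult_ac)
  then have "\<forall>a<N. g2 a = 0"
    by (intro power_sum_mem_prime[OF P(1) ideals(1) sub(1)]) (use f(1) mem 2 in auto)
  moreover have "0 \<in> P1" "0 \<in> P2" using ideals unfolding ideal_type_ring_iff by blast+
  ultimately have "g3 a b = 0" if "a < N" "b < N" for a b using 2(1)[of a] that by simp
  then show ?thesis using 3(1) \<open>0 \<in> P2\<close> by simp
qed

text \<open>
  Boxes of exponents are easy to count, and their bounds add up under multiplication of polynomials.
\<close>

definition expbox :: "'i set \<Rightarrow> nat \<Rightarrow> ('i \<Rightarrow>\<^sub>0 nat) set" where
  "expbox V D = {m. \<forall>v. Poly_Mapping.lookup m v \<le> (if v \<in> V then D else 0)}"

lemma expbox_card: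
  assumes "finite V"
  shows "finite (expbox V D)" "card (expbox V D) \<le> Suc D ^ card V"
proof -
  let ?r = "\<lambda>m. restrict (Poly_Mapping.lookup m) V"
  have inj: "inj_on ?r (expbox V D)"
  proof (rule inj_onI, rule poly_mapping_eqI)
    fix m m' v assume m: "m \<in> expbox V D" "m' \<in> expbox V D" "?r m = ?r m'"
    show "Poly_Mapping.lookup m v = Poly_Mapping.lookup m' v"
    proof (cases "v \<in> V")
      case True
      then show ?thesis using fun_cong[OF m(3), of v] by simp
    next
      case False
      have "Poly_Mapping.lookup m v \<le> (if v \<in> V then D else 0)"
        "Poly_Mapping.lookup m' v \<le> (if v \<in> V then D else 0)"
        using m(1,2) unfolding expbox_def by blast+
      then show ?thesis using False by simp
    qed
  qed
  have im: "?r ` expbox V D \<subseteq> PiE V (\<lambda>_. {..D})"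
    by (auto simp: expbox_def)
  have fin: "finite (PiE V (\<lambda>_. {..D}))" using assms by (intro finite_PiE) auto
  show "finite (expbox V D)" using inj_on_finite[OF inj im fin] .
  have "card (expbox V D) \<le> card (PiE V (\<lambda>_. {..D}))" by (rule card_inj_on_le[OF inj im fin])
  then show "card (expbox V D) \<le> Suc D ^ card V" using assms by (simp add: card_PiE)
qed

lemma keys_mult_expbox:
  assumes "Poly_Mapping.keys f \<subseteq> expbox V D" "Poly_Mapping.keys g \<subseteq> expbox V D'"
  shows "Poly_Mapping.keys (f * g) \<subseteq> expbox V (D + D')"
proof
  fix m assume "m \<in> Poly_Mapping.keys (f * g)"
  then obtain a b where "m = a + b" "a \<in> expbox V D" "b \<in> expbox V D'"
    using Poly_Mapping.keys_mult[of f g] assms by blast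
  moreover have "Poly_Mapping.lookup a v + Poly_Mapping.lookup b v \<le> (if v \<in> V then D + D' else 0)" for v
  proof -
    have "Poly_Mapping.lookup a v \<le> (if v \<in> V then D else 0)"
      "Poly_Mapping.lookup b v \<le> (if v \<in> V then D' else 0)"
      using calculation unfolding expbox_def by blast+
    then show ?thesis by (cases "v \<in> V") auto
  qed
  ultimately show "m \<in> expbox V (D + D')" by (simp add: expbox_def lookup_add)
qed

lemma expbox_mono:
  assumes "D \<le> D'"
  shows "expbox V D \<subseteq> expbox V D'"
proof
  fix m assume m: "m \<in> expbox V D"
  have "Poly_Mapping.lookup m v \<le> (if v \<in> V then D' else 0)" for v
  proof -
    have "Poly_Mapping.lookup m v \<le> (if v \<in> V then D else 0)" using m unfolding expbox_def by blast
    also have "\<dots> \<le> (if v \<in> V then D' else 0)" using assms by simp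
    finally show ?thesis .
  qed
  then show "m \<in> expbox V D'" by (simp add: expbox_def)
qed

lemma keys_power_expbox:
  fixes f :: "('i, 'k::field) mpoly"
  assumes "Poly_Mapping.keys f \<subseteq> expbox V D"
  shows "Poly_Mapping.keys (f ^ n) \<subseteq> expbox V (n * D)"
proof (induction n)
  case 0
  then show ?case by (simp add: expbox_def)
next
  case (Suc n)
  then show ?case using keys_mult_expbox[OF assms Suc] by simp
qed

text \<open>
  Setting the variables outside \<open>V\<close> to zero does not change the class modulo \<open>P\<close>.
\<close>

lemma reduce_variables_mod_ideal:
  fixes f :: "('i, 'k::field) mpoly"
  assumes "ideal P mpoly_ring" "\<And>v. v \<notin> V \<Longrightarrow> Var v \<in> P"
  shows "\<exists>F D. f - F \<in> P \<and> Poly_Mapping.keys F \<subseteq> expbox V D"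
proof (induction f rule: mpoly_induct)
  case (Const c)
  show ?case using assms(1)
    by (intro exI[of _ "Const c"] exI[of _ 0]) (auto simp: ideal_type_ring_iff Const_def expbox_def)
next
  case (add f g)
  then obtain F D G D' where *: "f - F \<in> P" "Poly_Mapping.keys F \<subseteq> expbox V D"
     "g - G \<in> P" "Poly_Mapping.keys G \<subseteq> expbox V D'" by auto
  have "(f - F) + (g - G) \<in> P" using * assms(1) unfolding ideal_type_ring_iff by blast
  then have "f + g - (F + G) \<in> P" by (simp add: algebra_simps)
  moreover have "Poly_Mapping.keys (F + G) \<subseteq> expbox V (max D D')"
  proof -
    have "expbox V D \<subseteq> expbox V (max D D')" "expbox V D' \<subseteq> expbox V (max D D')"
      by (auto intro!: expbox_mono)
    then show ?thesis using Poly_Mapping.keys_add[of F G] *(2,4) by blast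
  qed
  ultimately show ?case by blast
next
  case (Var_mult v f)
  then obtain F D where *: "f - F \<in> P" "Poly_Mapping.keys F \<subseteq> expbox V D" by auto
  show ?case
  proof (cases "v \<in> V")
    case True
    have "Var v * (f - F) \<in> P" using * assms(1) unfolding ideal_type_ring_iff by blast
    moreover have "Poly_Mapping.keys (Var v :: ('i, 'k) mpoly) \<subseteq> expbox V 1"
      using True by (simp add: Var_def expbox_def lookup_single when_def)
    ultimately have "Var v * f - Var v * F \<in> P" "Poly_Mapping.keys (Var v * F) \<subseteq> expbox V (1 + D)"
      using keys_mult_expbox[OF _ *(2)] by (simp_all only: right_diff_distrib)
    then show ?thesis by blast
  next
    case False
    then have "f * Var v \<in> P" using assms unfolding ideal_type_ring_iff by blast
    then show ?thesis by (intro exI[of _ 0]) (simp add: mult.commute)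
  qed
qed

lemma lookup_Const_mult: "Poly_Mapping.lookup (Const k * f) m = k * Poly_Mapping.lookup f m"
  for f :: "('i, 'k::field) mpoly"
proof (induction f rule: poly_mapping_single_add_induct)
  case (single m' c)
  then show ?case by (simp add: Const_def mult_single lookup_single when_def)
qed (simp add: distrib_left lookup_add)

text \<open>
  The number of monomials in three quantities with exponents below \<open>N\<close> is \<open>N\<^sup>3\<close>, while the polynomials obtained lie in a
  space whose dimension grows at most like \<open>N\<^sup>2\<close>.
\<close>

lemma three_polynomials_in_two_variables_dependent:
  fixes F1 F2 F3 :: "('i, 'k::field) mpoly"
  assumes V: "finite V" "card V \<le> 2"
    and F: "Poly_Mapping.keys F1 \<subseteq> expbox V D" "Poly_Mapping.keys F2 \<subseteq> expbox V D"
      "Poly_Mapping.keys F3 \<subseteq> expbox V D"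
  shows "\<exists>N k. (\<exists>a<N. \<exists>b<N. \<exists>c<N. k a b c \<noteq> 0) \<and>
    (\<Sum>a<N. \<Sum>b<N. \<Sum>c<N. Const (k a b c) * (F1 ^ a * (F2 ^ b * F3 ^ c))) = 0"
proof -
  define D' where "D' = Suc D"
  \<comment> \<open>The bound on the dimension is \<open>(3 D' N + 1)\<^sup>2 \<le> 16 D'\<^sup>2 N\<^sup>2\<close>, which is less than \<open>N\<^sup>3\<close> for this \<open>N\<close>.\<close>
  define N where "N = Suc (16 * D' ^ 2)"
  define T where "T = {..<N} \<times> {..<N} \<times> {..<N}"
  define Y where "Y = expbox V (3 * D' * N)"
  define M where "M = (\<lambda>(a, b, c). F1 ^ a * (F2 ^ b * F3 ^ c))"
  have "1 \<le> D' * N" by (simp add: D'_def N_def)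
  have "card Y \<le> Suc (3 * D' * N) ^ card V" unfolding Y_def by (rule expbox_card(2)[OF V(1)])
  also have "\<dots> \<le> Suc (3 * D' * N) ^ 2" using V(2) by (intro power_increasing) auto
  also have "\<dots> \<le> (4 * D' * N) ^ 2" using \<open>1 \<le> D' * N\<close> by (intro power_mono) (auto simp: mult.assoc)
  also have "\<dots> = (16 * D' ^ 2) * N ^ 2" by (simp add: power_mult_distrib)
  also have "\<dots> < N * N ^ 2" by (simp add: N_def)
  also have "\<dots> = card T" by (simp add: T_def card_cartesian_product power2_eq_square)
  finally have "card Y < card T" .
  then obtain c where c: "\<exists>t\<in>T. c t \<noteq> 0" 
    "\<forall>x\<in>Y. (\<Sum>t\<in>T. c t * Poly_Mapping.lookup (M t) x) = 0"
    using underdetermined_linear_system[of Y T "\<lambda>t. Poly_Mapping.lookup (M t)"] expbox_card(1)[OF V(1)]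
    by (auto simp: Y_def T_def)
  have keys: "Poly_Mapping.keys (M t) \<subseteq> Y" if "t \<in> T" for t
  proof -
    obtain a b c where t: "t = (a, b, c)" "a < N" "b < N" "c < N" using \<open>t \<in> T\<close> by (auto simp: T_def)
    have "Poly_Mapping.keys (M t) \<subseteq> expbox V (a * D + (b * D + c * D))"
      unfolding t M_def prod.case by (intro keys_mult_expbox keys_power_expbox F)
    moreover have "a * D + (b * D + c * D) \<le> N * D' + (N * D' + N * D')"
      using t by (intro add_mono mult_mono) (auto simp: D'_def)
    ultimately show ?thesis unfolding Y_def
      using expbox_mono[of "a * D + (b * D + c * D)" "3 * D' * N" V] by (auto simp: algebra_simps)
  qed
  have "(\<Sum>t\<in>T. Const (c t) * M t) = 0"
  proof (rule poly_mapping_eqI)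
    fix x
    have "(\<Sum>t\<in>T. c t * Poly_Mapping.lookup (M t) x) = 0"
    proof (cases "x \<in> Y")
      case False
      then have "Poly_Mapping.lookup (M t) x = 0" if "t \<in> T" for t
        using keys[OF that] by (auto simp: in_keys_iff)
      then show ?thesis by simp
    qed (use c(2) in auto)
    then show "Poly_Mapping.lookup (\<Sum>t\<in>T. Const (c t) * M t) x = Poly_Mapping.lookup 0 x"
      by (simp add: lookup_sum lookup_Const_mult)
  qed
  then have "(\<Sum>a<N. \<Sum>b<N. \<Sum>d<N. Const (c (a, b, d)) * (F1 ^ a * (F2 ^ b * F3 ^ d))) = 0"
    by (simp add: T_def M_def sum.cartesian_product case_prod_unfold)
  moreover have "\<exists>a<N. \<exists>b<N. \<exists>d<N. c (a, b, d) \<noteq> 0" using c(1) by (auto simp: T_def)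
  ultimately show ?thesis by (intro exI[of _ N] exI[of _ "\<lambda>a b d. c (a, b, d)"]) auto
qed

lemma no_long_prime_chain:
  fixes P0 P1 P2 P3 :: "('i, 'k::field) mpoly set"
  assumes P: "primeideal P0 mpoly_ring" "primeideal P1 mpoly_ring"
      "primeideal P2 mpoly_ring" "primeideal P3 mpoly_ring"
    and sub: "P0 \<subset> P1" "P1 \<subset> P2" "P2 \<subset> P3"
    and V: "finite V" "card V \<le> 2" "\<And>v. v \<notin> V \<Longrightarrow> Var v \<in> P0"
  shows False
proof -
  have id0: "ideal P0 mpoly_ring" using P(1) by (rule primeideal.axioms(1))
  have ex: "\<exists>F D. F \<in> B - A \<and> Poly_Mapping.keys F \<subseteq> expbox V D"
    if A: "primeideal A mpoly_ring" "P0 \<subseteq> A" and B: "primeideal B mpoly_ring" "A \<subset> B" for A B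
  proof -
    obtain f where f: "f \<in> B" "f \<notin> A" using B(2) by auto
    obtain F D where F: "f - F \<in> P0" "Poly_Mapping.keys F \<subseteq> expbox V D"
      using reduce_variables_mod_ideal[OF id0 V(3)] by blast
    have A': "ideal A mpoly_ring" and B': "ideal B mpoly_ring" using A B by (auto dest: primeideal.axioms(1))
    have "F \<notin> A"
    proof
      assume "F \<in> A"
      then have "(f - F) + F \<in> A" using A' F(1) A(2) unfolding ideal_type_ring_iff by blast
      then show False using f by simp
    qed
    moreover have "f + (-1) * (f - F) \<in> B" using B' F(1) A(2) B(2) f unfolding ideal_type_ring_iff by blast
    then have "F \<in> B" by simp
    ultimately show ?thesis using F(2) by blast
  qed
  obtain F1 D1 where 1: "F1 \<in> P1 - P0" "Poly_Mapping.keys F1 \<subseteq> expbox V D1"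
    using ex[OF P(1) _ P(2)] sub by blast
  obtain F2 D2 where 2: "F2 \<in> P2 - P1" "Poly_Mapping.keys F2 \<subseteq> expbox V D2"
    using ex[OF P(2) _ P(3)] sub by blast
  obtain F3 D3 where 3: "F3 \<in> P3 - P2" "Poly_Mapping.keys F3 \<subseteq> expbox V D3"
    using ex[OF P(3) _ P(4)] sub by blast
  define D where "D = D1 + D2 + D3"
  have keys: "Poly_Mapping.keys F1 \<subseteq> expbox V D" "Poly_Mapping.keys F2 \<subseteq> expbox V D"
    "Poly_Mapping.keys F3 \<subseteq> expbox V D"
  proof -
    have "expbox V D1 \<subseteq> expbox V D" "expbox V D2 \<subseteq> expbox V D" "expbox V D3 \<subseteq> expbox V D"
      by (auto simp: D_def intro!: expbox_mono)
    then show "Poly_Mapping.keys F1 \<subseteq> expbox V D" "Poly_Mapping.keys F2 \<subseteq> expbox V D"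
      "Poly_Mapping.keys F3 \<subseteq> expbox V D" using 1(2) 2(2) 3(2) by auto
  qed
  obtain N k where "(\<exists>a<N. \<exists>b<N. \<exists>c<N. k a b c \<noteq> 0) \<and>
    (\<Sum>a<N. \<Sum>b<N. \<Sum>c<N. Const (k a b c) * (F1 ^ a * (F2 ^ b * F3 ^ c))) = 0"
    using three_polynomials_in_two_variables_dependent[OF V(1,2) keys] by (elim exE) (rule that)
  note k = conjunct1[OF this] conjunct2[OF this]
  have "0 \<in> P0" using id0 by (simp add: ideal_type_ring_iff)
  then have "(\<Sum>a<N. \<Sum>b<N. \<Sum>c<N. Const (k a b c) * (F1 ^ a * (F2 ^ b * F3 ^ c))) \<in> P0"
    by (simp only: k(2))
  then have "\<forall>a<N. \<forall>b<N. \<forall>c<N. k a b c = 0"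
    by (intro prime_chain_algebraically_independent[OF P _ _ _ 1(1) 2(1) 3(1)])
       (use sub in \<open>simp_all add: psubset_imp_subset\<close>)
  with k(1) show False by blast
qed

lemma primeideal_SR_ring_vimage:
  fixes P :: "('v, 'k::field) mpoly set set"
  assumes "primeideal P (SR_ring E)"
  shows "primeideal {f. SR_class E f \<in> P} mpoly_ring"
proof -
  interpret P: primeideal P "SR_ring E" by (rule assms)
  interpret H: ring_hom_ring mpoly_ring "SR_ring E :: ('v, 'k) mpoly set ring" "SR_class E"
    using SR_ring_presentation(1,2) cring_mpoly_ring by (intro ring_hom_ringI2) (auto intro: cring.axioms(1))
  have "ideal {f. SR_class E f \<in> P} mpoly_ring"
    using H.ideal_vimage[OF P.is_ideal] by simp
  moreover have "{f. SR_class E f \<in> P} \<noteq> UNIV"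
    using P.I_notcarr SR_ring_presentation(3)[of E, where 'k = 'k] P.Icarr by auto
  moreover have "f \<in> {f. SR_class E f \<in> P} \<or> g \<in> {f. SR_class E f \<in> P}"
    if "f * g \<in> {f. SR_class E f \<in> P}" for f g
    using that P.I_prime[of "SR_class E f" "SR_class E g"] SR_ring_presentation(3)[of E, where 'k = 'k]
    by (simp add: H.hom_mult[simplified])
  ultimately show ?thesis
    by (intro primeidealI cring_mpoly_ring) auto
qed

text \<open>
  A product of three distinct variables is zero in the Stanley-Reisner ring.
\<close>

lemma prime_SR_ring_support:
  fixes P :: "('v::finite, 'k::field) mpoly set"
  assumes P: "primeideal P mpoly_ring" and "SR_gens E \<subseteq> P"
  shows "card {v. Var v \<notin> P} \<le> 2"
proof (rule ccontr)
  interpret primeideal P mpoly_ring by (rule P)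
  let ?V = "{v. Var v \<notin> P}"
  assume "\<not> card ?V \<le> 2"
  then obtain W where "W \<subseteq> ?V" "card W = 3"
    using obtain_subset_with_card_n[of 3 ?V] by auto
  then obtain i j m where *: "i \<in> ?V" "j \<in> ?V" "m \<in> ?V" "i \<noteq> j" "i \<noteq> m" "j \<noteq> m"
    by (auto simp: card_3_iff)
  then have "Var i * Var j * Var m \<in> P" using assms(2) unfolding SR_gens_def by blast
  then show False using * I_prime[of "Var i * Var j" "Var m"] I_prime[of "Var i" "Var j"] by auto
qed

lemma krull_dim_SR_ring_le_2:
  "krull_dim (SR_ring E :: ('v::finite, 'k::field) mpoly set ring) \<le> 2"
  unfolding krull_dim_def
proof (rule SUP_least)
  fix Ps :: "('v, 'k) mpoly set set list"
  assume "Ps \<in> {Ps. Ps \<noteq> [] \<and> (\<forall>P\<in>set Ps. primeideal P (SR_ring E)) \<and> sorted_wrt (\<subset>) Ps}"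
  then have pr: "\<And>P. P \<in> set Ps \<Longrightarrow> primeideal P (SR_ring E)" and so: "sorted_wrt (\<subset>) Ps" by auto
  define Q where "Q i = {f. SR_class E f \<in> Ps ! i}" for i
  have "length Ps \<le> 3"
  proof (rule ccontr)
    assume "\<not> length Ps \<le> 3"
    then have l: "length Ps > 3" by simp
    have Qp: "primeideal (Q i) mpoly_ring" if "i < 4" for i
      unfolding Q_def by (rule primeideal_SR_ring_vimage[OF pr]) (use l that in auto)
    have Qs: "Q i \<subset> Q (Suc i)" if "i < 3" for i
    proof -
      have "Ps ! i \<subset> Ps ! Suc i" using so l that by (intro sorted_wrt_nth_less) auto
      moreover have "Ps ! Suc i \<subseteq> range (SR_class E)"
        using ideal.Icarr[OF primeideal.axioms(1)[OF pr[of "Ps ! Suc i"]]] l that 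
          SR_ring_presentation(3)[of E, where 'k = 'k] by auto
      ultimately show ?thesis unfolding Q_def by blast
    qed
    have gens: "SR_gens E \<subseteq> Q 0"
    proof
      fix f :: "('v, 'k) mpoly" assume "f \<in> SR_gens E"
      then have "SR_class E f = \<zero>\<^bsub>SR_ring E\<^esub>" using SR_gens_subset SR_ring_presentation(4) by blast
      moreover have "primeideal (Ps ! 0) (SR_ring E)" using l by (intro pr nth_mem) auto
      then have "\<zero>\<^bsub>SR_ring E\<^esub> \<in> Ps ! 0"
        by (intro additive_subgroup.zero_closed ideal.axioms(1) primeideal.axioms(1))
      ultimately show "f \<in> Q 0" by (simp add: Q_def)
    qed
    show False
      by (rule no_long_prime_chain[of "Q 0" "Q 1" "Q 2" "Q 3" "{v. Var v \<notin> Q 0}"])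
         (use Qp Qs[of 0] Qs[of 1] Qs[of 2] prime_SR_ring_support[OF Qp[of 0] gens] 
           in \<open>auto simp: eval_nat_numeral\<close>)
  qed
  then show "enat (length Ps - 1) \<le> 2" by (simp add: numeral_eq_enat)
qed

text \<open>
  The kernel of a map to a domain is prime, also after passing to the Stanley-Reisner ring through which the map factors.
\<close>

lemma primeideal_SR_class_image:
  fixes H :: "('v, 'k::field) mpoly \<Rightarrow> 'b::idom"
  assumes add: "\<And>f g. H (f + g) = H f + H g" and mult: "\<And>f g. H (f * g) = H f * H g"
    and one: "H 1 = 1" and gens: "\<And>f. f \<in> SR_gens E \<Longrightarrow> H f = 0"
  shows "primeideal (SR_class E ` {f. H f = 0}) (SR_ring E)"
proof -
  let ?M = "{f. H f = 0}"
  have "H 0 = H (0 + 0) - H 0" unfolding add by simp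
  then have "H 0 = 0" by simp
  have M: "ideal ?M mpoly_ring" "SR_gens E \<subseteq> ?M"
    unfolding ideal_type_ring_iff using gens \<open>H 0 = 0\<close> by (simp_all add: add mult subset_iff)
  note mem = SR_class_image_ideal(2)[OF M]
  note S = SR_ring_presentation[of E, where 'k = 'k]
  show ?thesis
  proof (rule primeidealI[OF SR_class_image_ideal(1)[OF M] S(1)])
    show "carrier (SR_ring E) \<noteq> SR_class E ` ?M"
    proof
      assume "carrier (SR_ring E) = SR_class E ` ?M"
      then have "SR_class E 1 \<in> SR_class E ` ?M" unfolding S(3)[symmetric] using S(3) by auto
      then show False unfolding mem by (simp add: one)
    qed
  next
    fix a b assume ab: "a \<in> carrier (SR_ring E)" "b \<in> carrier (SR_ring E)" 
      "a \<otimes>\<^bsub>SR_ring E\<^esub> b \<in> SR_class E ` ?M"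
    then obtain f g where fg: "a = SR_class E f" "b = SR_class E g" unfolding S(3) by auto
    have "a \<otimes>\<^bsub>SR_ring E\<^esub> b = SR_class E (f * g)" unfolding fg using S(2) by (auto simp: ring_hom_def)
    then show "a \<in> SR_class E ` ?M \<or> b \<in> SR_class E ` ?M"
      using ab(3) unfolding fg by (simp only: mem) (auto simp: mult)
  qed
qed

text \<open>
  A chain of length two is given by an edge \<open>{i, j}\<close>: map all other variables to zero, then \<open>T\<^sub>i\<close> as well, and
  finally also \<open>T\<^sub>j\<close>.
\<close>

lemma krull_dim_SR_ring:
  fixes E :: "'v::finite set set"
  assumes edge: "{i, j} \<in> E" "i \<noteq> j"
  shows "krull_dim (SR_ring E :: ('v, 'k::field) mpoly set ring) = 2"
proof (rule antisym[OF krull_dim_SR_ring_le_2])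
  interpret scalar_hom "\<lambda>k::'k. [:[:k:]:]"
    by unfold_locales (simp_all flip: one_pCons)
  define x :: "'v \<Rightarrow> 'k poly poly" where
    "x v = (if v = i then [:0, 1:] else if v = j then [:[:0, 1:]:] else 0)" for v
  define H0 where "H0 = insertion (\<lambda>k::'k. [:[:k:]:]) x"
  define H1 where "H1 f = poly (H0 f) 0" for f
  define H2 where "H2 f = poly (H1 f) 0" for f
  have gens: "H0 f = 0" if "f \<in> SR_gens E" for f
    using that edge by (auto simp: SR_gens_def H0_def insertion_simps x_def insert_commute)
  have "primeideal (SR_class E ` {f. H0 f = 0}) (SR_ring E)"
    by (rule primeideal_SR_class_image) (auto simp: gens, auto simp: H0_def insertion_simps)
  moreover have "primeideal (SR_class E ` {f. H1 f = 0}) (SR_ring E)"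
    by (rule primeideal_SR_class_image) (auto simp: gens H1_def, auto simp: H0_def insertion_simps)
  moreover have "primeideal (SR_class E ` {f. H2 f = 0}) (SR_ring E)"
    by (rule primeideal_SR_class_image) (auto simp: gens H1_def H2_def, auto simp: H0_def insertion_simps)
  moreover have "SR_class E ` {f. H0 f = 0} \<subset> SR_class E ` {f. H1 f = 0}"
  proof -
    have "ideal {f. H0 f = 0} mpoly_ring" "SR_gens E \<subseteq> {f. H0 f = 0}"
      using gens by (auto simp: ideal_type_ring_iff) (auto simp: H0_def insertion_simps)
    note mem = SR_class_image_ideal(2)[OF this, of "Var i"]
    have "SR_class E (Var i) \<notin> SR_class E ` {f. H0 f = 0}"
      unfolding mem by (simp add: H0_def insertion_simps x_def)
    moreover have "H1 (Var i) = 0" by (simp add: H1_def H0_def insertion_simps x_def)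
    ultimately show ?thesis by (auto simp: H1_def)
  qed
  moreover have "SR_class E ` {f. H1 f = 0} \<subset> SR_class E ` {f. H2 f = 0}"
  proof -
    have "ideal {f. H1 f = 0} mpoly_ring" "SR_gens E \<subseteq> {f. H1 f = 0}"
      using gens by (auto simp: ideal_type_ring_iff H1_def) (auto simp: H0_def insertion_simps)
    note mem = SR_class_image_ideal(2)[OF this, of "Var j"]
    have "SR_class E (Var j) \<notin> SR_class E ` {f. H1 f = 0}"
      unfolding mem using edge by (simp add: H1_def H0_def insertion_simps x_def)
    moreover have "H2 (Var j) = 0" using edge by (simp add: H2_def H1_def H0_def insertion_simps x_def)
    ultimately show ?thesis by (auto simp: H2_def)
  qed
  ultimately have "[SR_class E ` {f. H0 f = 0}, SR_class E ` {f. H1 f = 0}, SR_class E ` {f. H2 f = 0}]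
     \<in> {Ps. Ps \<noteq> [] \<and> (\<forall>P\<in>set Ps. primeideal P (SR_ring E)) \<and> sorted_wrt (\<subset>) Ps}" (is "?Ps \<in> ?C")
    by auto
  then have "enat (length ?Ps - 1) \<le> krull_dim (SR_ring E :: ('v, 'k) mpoly set ring)"
    unfolding krull_dim_def by (rule SUP_upper)
  then show "2 \<le> krull_dim (SR_ring E :: ('v, 'k) mpoly set ring)" by (simp add: numeral_eq_enat numeral_2_eq_2)
qed


section \<open>Low degrees and the weak Lefschetz property\<close>

text \<open>
  The eliminations below only take linear combinations over \<open>K\<close>. They are applied to ideals \<open>J\<close> and to
  \<open>J + z R\<^sub>1\<close>.
\<close>

definition lin_subspace :: "('i, 'k::field) mpoly set \<Rightarrow> bool" where
  "lin_subspace W \<longleftrightarrow> 0 \<in> W \<and> (\<forall>f\<in>W. \<forall>g\<in>W. f + g \<in> W) \<and> (\<forall>f\<in>W. \<forall>k. Const k * f \<in> W)"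

lemma lin_subspace_ideal: "ideal J mpoly_ring \<Longrightarrow> lin_subspace J"
  unfolding lin_subspace_def ideal_type_ring_iff by blast

context
  fixes W :: "('i, 'k::field) mpoly set"
  assumes W: "lin_subspace W"
begin

lemma lin_subspace_0: "0 \<in> W" and lin_subspace_add: "f \<in> W \<Longrightarrow> g \<in> W \<Longrightarrow> f + g \<in> W"
  and lin_subspace_Const: "f \<in> W \<Longrightarrow> Const k * f \<in> W"
  using W by (auto simp: lin_subspace_def)

lemma lin_subspace_minus: "f \<in> W \<Longrightarrow> - f \<in> W"
  using lin_subspace_Const[of f "- 1"] by (simp add: Const_minus)

lemma lin_subspace_diff: "f \<in> W \<Longrightarrow> g \<in> W \<Longrightarrow> f - g \<in> W"
  using lin_subspace_add[of f "- g"] lin_subspace_minus[of g] by simp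

lemma lin_subspace_sum: "(\<And>a. a \<in> A \<Longrightarrow> f a \<in> W) \<Longrightarrow> (\<Sum>a\<in>A. f a) \<in> W"
  by (induction A rule: infinite_finite_induct) (auto intro: lin_subspace_0 lin_subspace_add)

lemma lin_subspace_Const_cancel:
  assumes "Const k * f \<in> W" "k \<noteq> 0"
  shows "f \<in> W"
  using lin_subspace_Const[OF assms(1), of "inverse k"] assms(2)
  by (simp add: mult.assoc[symmetric] flip: Const_mult)

lemma lin_subspace_solve2:
  assumes "Const a1 * y + Const b1 * z \<in> W" "Const a2 * y + Const b2 * z \<in> W"
    and "a1 * b2 - b1 * a2 \<noteq> 0"
  shows "y \<in> W" "z \<in> W"
proof -
  have "Const (a1 * b2 - b1 * a2) * y =
    Const b2 * (Const a1 * y + Const b1 * z) - Const b1 * (Const a2 * y + Const b2 * z)"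
    by (simp add: Const_hom algebra_simps)
  then show "y \<in> W" using assms by (metis lin_subspace_Const lin_subspace_diff lin_subspace_Const_cancel)
  have "Const (a1 * b2 - b1 * a2) * z =
    Const a1 * (Const a2 * y + Const b2 * z) - Const a2 * (Const a1 * y + Const b1 * z)"
    by (simp add: Const_hom algebra_simps)
  then show "z \<in> W" using assms by (metis lin_subspace_Const lin_subspace_diff lin_subspace_Const_cancel)
qed

text \<open>
  Cramer's rule for three unknown polynomials modulo a subspace.
\<close>

lemma lin_subspace_solve3:
  assumes r: "Const a1 * x + Const b1 * y + Const d1 * z \<in> W" 
      "Const a2 * x + Const b2 * y + Const d2 * z \<in> W"
      "Const a3 * x + Const b3 * y + Const d3 * z \<in> W"
    and det: "a1 * (b2 * d3 - b3 * d2) - b1 * (a2 * d3 - a3 * d2) + d1 * (a2 * b3 - a3 * b2) \<noteq> 0"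
      (is "?D \<noteq> 0")
  shows "x \<in> W" "y \<in> W" "z \<in> W"
proof -
  note closed = lin_subspace_add lin_subspace_Const r
  have "Const ?D * x = 
    Const (b2 * d3 - b3 * d2) * (Const a1 * x + Const b1 * y + Const d1 * z) +
    Const (b3 * d1 - b1 * d3) * (Const a2 * x + Const b2 * y + Const d2 * z) +
    Const (b1 * d2 - b2 * d1) * (Const a3 * x + Const b3 * y + Const d3 * z)"
    by (simp add: Const_hom algebra_simps)
  also have "\<dots> \<in> W" by (intro closed)
  finally show "x \<in> W" using det by (rule lin_subspace_Const_cancel)
  have "Const ?D * y = 
    Const (a3 * d2 - a2 * d3) * (Const a1 * x + Const b1 * y + Const d1 * z) +
    Const (a1 * d3 - a3 * d1) * (Const a2 * x + Const b2 * y + Const d2 * z) +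
    Const (a2 * d1 - a1 * d2) * (Const a3 * x + Const b3 * y + Const d3 * z)"
    by (simp add: Const_hom algebra_simps)
  also have "\<dots> \<in> W" by (intro closed)
  finally show "y \<in> W" using det by (rule lin_subspace_Const_cancel)
  have "Const ?D * z = 
    Const (a2 * b3 - a3 * b2) * (Const a1 * x + Const b1 * y + Const d1 * z) +
    Const (a3 * b1 - a1 * b3) * (Const a2 * x + Const b2 * y + Const d2 * z) +
    Const (a1 * b2 - a2 * b1) * (Const a3 * x + Const b3 * y + Const d3 * z)"
    by (simp add: Const_hom algebra_simps)
  also have "\<dots> \<in> W" by (intro closed)
  finally show "z \<in> W" using det by (rule lin_subspace_Const_cancel)
qed

end

lemma mult_linear_form: "f * linear_form c = (\<Sum>v\<in>UNIV. Const (c v) * (f * Var v))"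
  by (simp add: linear_form_def sum_distrib_left mult.left_commute)

text \<open>
  The basic step of all eliminations below: of the terms of \<open>f l\<close> for a linear form \<open>l\<close>, only those survive whose
  variable lies in \<open>S\<close>.
\<close>

lemma lin_subspace_linear_form_restrict:
  fixes W :: "('i::finite, 'k::field) mpoly set"
  assumes W: "lin_subspace W" and "f * linear_form c \<in> W" and "\<And>v. v \<notin> S \<Longrightarrow> f * Var v \<in> W"
  shows "(\<Sum>v\<in>S. Const (c v) * (f * Var v)) \<in> W"
proof -
  have "f * linear_form c = (\<Sum>v\<in>S. Const (c v) * (f * Var v)) + (\<Sum>v\<in>-S. Const (c v) * (f * Var v))"
    unfolding mult_linear_form by (subst sum.union_disjoint[symmetric]) (auto simp: Compl_partition)
  moreover have "(\<Sum>v\<in>-S. Const (c v) * (f * Var v)) \<in> W"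
    using assms by (intro lin_subspace_sum lin_subspace_Const) auto
  ultimately show ?thesis using lin_subspace_diff[OF W assms(2)] by fastforce
qed

lemma linear_form_add: "linear_form (\<lambda>v. a v + b v) = linear_form a + linear_form b"
  by (simp add: linear_form_def Const_add distrib_right sum.distrib)

lemma linear_form_single: "linear_form (\<lambda>v. if v = w then k else 0) = Const k * Var w"
  unfolding linear_form_def by (subst sum.remove[of UNIV w]) (auto intro!: sum.neutral)

definition quad_form :: "('i::finite \<Rightarrow> 'i \<Rightarrow> 'k::field) \<Rightarrow> ('i, 'k) mpoly" where
  "quad_form b = (\<Sum>u\<in>UNIV. \<Sum>v\<in>UNIV. Const (b u v) * (Var u * Var v))"

lemma quad_form_add: "quad_form (\<lambda>u v. a u v + b u v) = quad_form a + quad_form b"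
  by (simp add: quad_form_def Const_add distrib_right sum.distrib)

lemma Var_mult_linear_form: "Var w * linear_form a = quad_form (\<lambda>u v. if u = w then a v else 0)"
proof -
  have "quad_form (\<lambda>u v. if u = w then a v else 0) = (\<Sum>v\<in>UNIV. Const (a v) * (Var w * Var v))"
    unfolding quad_form_def by (subst sum.remove[of UNIV w]) (auto intro!: sum.neutral)
  then show ?thesis by (simp add: mult_linear_form)
qed

lemma quad_form_mem:
  assumes "lin_subspace W" "\<And>u v. Var u * Var v \<in> W"
  shows "quad_form b \<in> W"
  unfolding quad_form_def using assms by (intro lin_subspace_sum lin_subspace_Const)

lemma linear_form_mem:
  assumes "lin_subspace W" "\<And>u. Var u \<in> W"
  shows "linear_form a \<in> W"
  unfolding linear_form_def using assms by (intro lin_subspace_sum lin_subspace_Const)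

lemma Var_mult_quad_form_mem:
  assumes J: "ideal J mpoly_ring" and cubic: "\<And>u v w. Var u * Var v * Var w \<in> J"
  shows "Var w * quad_form b \<in> J"
proof -
  have "Var w * quad_form b = (\<Sum>u\<in>UNIV. \<Sum>v\<in>UNIV. Const (b u v) * (Var w * Var u * Var v))"
    by (simp add: quad_form_def sum_distrib_left mult_ac)
  also have "\<dots> \<in> J" using cubic
    by (intro lin_subspace_sum lin_subspace_Const lin_subspace_ideal[OF J])
  finally show ?thesis .
qed

text \<open>
  If all monomials of degree three are in \<open>J\<close>, then the quotient has no part of degree larger than two.
\<close>

lemma degree_two_normal_form:
  fixes f :: "('v::finite, 'k::field) mpoly"
  assumes J: "ideal J mpoly_ring" and cubic: "\<And>u v w. Var u * Var v * Var w \<in> J"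
  shows "\<exists>k a b. f - (Const k + linear_form a + quad_form b) \<in> J"
proof (induction f rule: mpoly_induct)
  case (Const c)
  have "linear_form (\<lambda>_. 0) = (0 :: ('v, 'k) mpoly)" "quad_form (\<lambda>_ _. 0) = (0 :: ('v, 'k) mpoly)"
    by (simp_all add: linear_form_def quad_form_def)
  then show ?case using lin_subspace_0[OF lin_subspace_ideal[OF J]]
    by (intro exI[of _ c] exI[of _ "\<lambda>_. 0"] exI[of _ "\<lambda>_ _. 0"]) simp
next
  case (add f g)
  then obtain k a b k' a' b' where "f - (Const k + linear_form a + quad_form b) \<in> J"
    "g - (Const k' + linear_form a' + quad_form b') \<in> J" by blast
  then have "(f - (Const k + linear_form a + quad_form b)) + (g - (Const k' + linear_form a' + quad_form b')) \<in> J"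
    by (rule lin_subspace_add[OF lin_subspace_ideal[OF J]])
  also have "(f - (Const k + linear_form a + quad_form b)) + (g - (Const k' + linear_form a' + quad_form b')) =
    f + g - (Const (k + k') + linear_form (\<lambda>v. a v + a' v) + quad_form (\<lambda>u v. b u v + b' u v))"
    by (simp add: Const_add linear_form_add quad_form_add)
  finally show ?case by blast
next
  case (Var_mult w f)
  then obtain k a b where "f - (Const k + linear_form a + quad_form b) \<in> J" by blast
  then have "Var w * (f - (Const k + linear_form a + quad_form b)) \<in> J"
    using J unfolding ideal_type_ring_iff by blast
  from lin_subspace_add[OF lin_subspace_ideal[OF J] this Var_mult_quad_form_mem[OF J cubic, of w b]]
  have "Var w * f - (Const 0 + linear_form (\<lambda>v. if v = w then k else 0) 
      + quad_form (\<lambda>u v. if u = w then a v else 0)) \<in> J"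
    unfolding linear_form_single Var_mult_linear_form[symmetric]
    by (simp add: algebra_simps)
  then show ?case by blast
qed

lemma nonadjacent_mem_SR_gens: "u \<noteq> v \<Longrightarrow> {u, v} \<notin> E \<Longrightarrow> Var u * Var v \<in> SR_gens E"
  unfolding SR_gens_def by blast

lemma distinct_mem_SR_gens: "u \<noteq> v \<Longrightarrow> u \<noteq> w \<Longrightarrow> v \<noteq> w \<Longrightarrow> Var u * Var v * Var w \<in> SR_gens E"
  unfolding SR_gens_def by blast

text \<open>
  For an edge \<open>{u, v}\<close> the monomials \<open>T\<^sub>u T\<^sub>v T\<^sub>w\<close> with a third vertex \<open>w\<close> vanish, so that \<open>T\<^sub>u T\<^sub>v l\<^sub>1\<close> and
  \<open>T\<^sub>u T\<^sub>v l\<^sub>2\<close> are combinations of \<open>T\<^sub>u\<^sup>2 T\<^sub>v\<close> and \<open>T\<^sub>u T\<^sub>v\<^sup>2\<close>; the minor makes both vanish. After that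
  \<open>T\<^sub>u\<^sup>2 l\<^sub>k\<close> reduces to a multiple of \<open>T\<^sub>u\<^sup>3\<close>.
\<close>

lemma cubic_mem_ideal:
  fixes E :: "'v::finite set set" and J :: "('v, 'k::field) mpoly set"
  assumes J: "ideal J mpoly_ring" and gens: "SR_gens E \<subseteq> J"
    and l: "linear_form c1 \<in> J" "linear_form c2 \<in> J"
    and minor: "\<And>u v. u \<noteq> v \<Longrightarrow> {u, v} \<in> E \<Longrightarrow> c1 u * c2 v - c1 v * c2 u \<noteq> 0"
    and nz: "\<And>v. c1 v \<noteq> 0 \<or> c2 v \<noteq> 0"
  shows "Var u * Var v * Var w \<in> J"
proof -
  have sub: "lin_subspace J" by (rule lin_subspace_ideal[OF J])
  have mult: "g * f \<in> J" if "f \<in> J" for f g using J that unfolding ideal_type_ring_iff by blast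
  have sq: "Var u * Var u * Var v \<in> J" if "u \<noteq> v" for u v
  proof (cases "{u, v} \<in> E")
    case True
    have "(\<Sum>w\<in>{u, v}. Const (c w) * (Var u * Var v * Var w)) \<in> J" if "linear_form c \<in> J" for c
    proof (rule lin_subspace_linear_form_restrict[OF sub mult[OF that]])
      fix w assume "w \<notin> {u, v}"
      then show "Var u * Var v * Var w \<in> J"
        using distinct_mem_SR_gens[of u v w] gens \<open>u \<noteq> v\<close> by auto
    qed
    from this[OF l(1)] this[OF l(2)]
    have "Const (c1 u) * (Var u * Var v * Var u) + Const (c1 v) * (Var u * Var v * Var v) \<in> J"
      "Const (c2 u) * (Var u * Var v * Var u) + Const (c2 v) * (Var u * Var v * Var v) \<in> J"
      using that by auto
    from lin_subspace_solve2(1)[OF sub this minor[OF that True]] show ?thesis by (simp add: mult_ac)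
  next
    case False
    then have "Var u * (Var u * Var v) \<in> J" using nonadjacent_mem_SR_gens[OF that False] gens mult by blast
    then show ?thesis by (simp add: mult.assoc)
  qed
  have cube: "Var u * Var u * Var u \<in> J" for u
  proof -
    have "(\<Sum>w\<in>{u}. Const (c w) * (Var u * Var u * Var w)) \<in> J" if "linear_form c \<in> J" for c
      by (rule lin_subspace_linear_form_restrict[OF sub mult[OF that]]) (use sq in auto)
    from this[OF l(1)] this[OF l(2)] show ?thesis
      using nz[of u] by (auto intro: lin_subspace_Const_cancel[OF sub])
  qed
  consider "u = v" "v = w" | "u = v" "v \<noteq> w" | "u = w" "v \<noteq> w" | "v = w" "u \<noteq> v"
    | "u \<noteq> v" "u \<noteq> w" "v \<noteq> w" by blast
  then show ?thesis
  proof cases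
    case 1
    then show ?thesis using cube[of u] by simp
  next
    case 2
    then show ?thesis using sq[of v w] by simp
  next
    case 3
    then show ?thesis using sq[of u v] by (simp add: mult_ac)
  next
    case 4
    then show ?thesis using sq[of v u] by (simp add: mult_ac)
  next
    case 5
    then show ?thesis using distinct_mem_SR_gens[OF 5] gens by auto
  qed
qed

lemma one_notin_SR_quot_kernel:
  fixes E :: "'v::finite set set" and c1 c2 :: "'v \<Rightarrow> 'k::field"
  shows "1 \<notin> SR_quot_kernel E {linear_form c1, linear_form c2}"
proof -
  let ?M = "{f :: ('v, 'k) mpoly. Poly_Mapping.lookup f 0 = 0}"
  have V: "Poly_Mapping.lookup (Var v :: ('v, 'k) mpoly) 0 = 0" for v
    by (simp add: Var_uexp lookup_single when_def)
  have "ideal ?M mpoly_ring" by (auto simp: ideal_type_ring_iff lookup_add lookup_mult_0)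
  moreover have "SR_gens E \<subseteq> ?M" by (auto simp: SR_gens_def lookup_mult_0 V)
  moreover have "{linear_form c1, linear_form c2} \<subseteq> ?M"
    by (auto simp: linear_form_def lookup_sum lookup_mult_0 V)
  ultimately have "SR_quot_kernel E {linear_form c1, linear_form c2} \<subseteq> ?M" by (rule SR_quot_kernel_minimal)
  then show ?thesis by auto
qed

lemma SR_quot_finite_dimension:
  fixes E :: "'v::finite set set" and L :: "('v, 'k::field) mpoly set"
  assumes one: "1 \<notin> SR_quot_kernel E L"
    and cubic: "\<And>u v w. Var u * Var v * Var w \<in> SR_quot_kernel E L"
  shows "ring.finite_dimension (SR_quot E L) (SR_quot_class E L ` range Const) (carrier (SR_quot E L))"
proof -
  let ?R = "SR_quot E L" and ?pi = "SR_quot_class E L" and ?K = "SR_quot_class E L ` range Const"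
  interpret R: cring ?R by (rule SR_quot_presentation)
  have K: "subfield ?K ?R" by (rule subfield_SR_quot_Const[OF one])
  define G :: "('v, 'k) mpoly set" where "G = insert 1 (range Var \<union> (\<lambda>(u, v). Var u * Var v) ` UNIV)"
  have "finite G" by (simp add: G_def)
  then obtain gs where gs: "set gs = G" using finite_list by blast
  let ?Us = "map ?pi gs"
  have car: "set ?Us \<subseteq> carrier ?R" by (auto simp: SR_quot_class_simps)
  note span = R.Span_subgroup_props[OF K car] R.Span_smult_closed[OF K car]
  define W where "W = {f. ?pi f \<in> R.Span ?K ?Us}"
  have W: "lin_subspace W"
  proof -
    have "?pi 0 = \<zero>\<^bsub>?R\<^esub>" using ideal_SR_quot_kernel[of E L] 
      by (auto simp: ideal_type_ring_iff SR_quot_kernel_def)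
    then show ?thesis unfolding lin_subspace_def W_def
      using span(2,3,5) by (auto simp flip: SR_quot_class_simps)
  qed
  have "f \<in> W" if "f \<in> set gs" for f
    using R.Span_base_incl[OF K car] that by (auto simp: W_def)
  then have "1 \<in> W" "Var u \<in> W" "Var u * Var v \<in> W" for u v unfolding gs G_def by auto
  then have base: "Const k + linear_form a + quad_form b \<in> W" for k a b
    using lin_subspace_Const[OF W, of 1 k] linear_form_mem[OF W] quad_form_mem[OF W]
    by (auto intro!: lin_subspace_add[OF W])
  have "carrier ?R \<subseteq> R.Span ?K ?Us"
  proof
    fix x assume "x \<in> carrier ?R"
    then obtain f where f: "x = ?pi f" by (auto simp: SR_quot_presentation(3))
    obtain k a b where "f - (Const k + linear_form a + quad_form b) \<in> SR_quot_kernel E L"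
      using degree_two_normal_form[OF ideal_SR_quot_kernel cubic] by blast
    then have "x = ?pi (Const k + linear_form a + quad_form b)" by (simp add: f SR_quot_class_eq_iff)
    then show "x \<in> R.Span ?K ?Us" using base by (simp add: W_def)
  qed
  then have "R.Span ?K ?Us = carrier ?R" using span(1) by blast
  then show ?thesis using R.Span_finite_dimension[OF K car] by simp
qed

text \<open>
  The determinant of the columns \<open>u, v, w\<close> of the matrix with rows \<open>a, b, c\<close>.
\<close>

definition det3 :: "('v \<Rightarrow> 'k::field) \<Rightarrow> ('v \<Rightarrow> 'k) \<Rightarrow> ('v \<Rightarrow> 'k) \<Rightarrow> 'v \<Rightarrow> 'v \<Rightarrow> 'v \<Rightarrow> 'k" where
  "det3 a b c u v w = a u * (b v * c w - c v * b w) - a v * (b u * c w - c u * b w) + a w * (b u * c v - c u * b v)"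

text \<open>
  The structure of the graph with respect to the ordering, given by the position \<open>r v\<close> of a vertex: nothing precedes the
  first two vertices \<open>x1\<close> and \<open>x2\<close> along an edge, and every other vertex has exactly two neighbours before it. The common
  neighbour of \<open>x1\<close> and \<open>x2\<close> is the third vertex; it puts them on the same side of every bipartition.
\<close>

locale two_back_graph =
  fixes E :: "'v::finite set set" and r :: "'v \<Rightarrow> nat" and x1 x2 :: 'v
  assumes inj_r: "inj r"
    and start: "v \<in> {x1, x2} \<Longrightarrow> r t < r v \<Longrightarrow> {v, t} \<notin> E"
    and start_distinct: "x1 \<noteq> x2"
    and two_earlier: "v \<notin> {x1, x2} \<Longrightarrow> \<exists>u w. u \<noteq> w \<and> r u < r v \<and> r w < r v \<and> {v, u} \<in> E \<and> {v, w} \<in> E \<and>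
      (\<forall>t. r t < r v \<longrightarrow> {v, t} \<in> E \<longrightarrow> t = u \<or> t = w)"
    and common: "\<exists>y. {x1, y} \<in> E \<and> {x2, y} \<in> E"
    and simple: "simple_graph E"
begin

lemma edge_neq: "{u, v} \<in> E \<Longrightarrow> u \<noteq> v"
  using simple unfolding simple_graph_def by (cases "u = v") auto

text \<open>
  The induction runs from the last vertex to the first. At \<open>v\<close>, products with later variables are in \<open>W\<close> by the induction
  hypothesis and products with earlier variables are in \<open>W\<close> by assumption unless they belong to one of the two earlier neighbours,
  so that three unknown products remain for three relations. At \<open>x1\<close> and \<open>x2\<close> only the square remains.
\<close>

lemma quadrics_mem:
  fixes W :: "('v, 'k::field) mpoly set"
  assumes W: "lin_subspace W" and nonadj: "\<And>u v. u \<noteq> v \<Longrightarrow> {u, v} \<notin> E \<Longrightarrow> Var u * Var v \<in> W"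
    and l: "\<And>v. Var v * linear_form c1 \<in> W" "\<And>v. Var v * linear_form c2 \<in> W" "\<And>v. Var v * linear_form c3 \<in> W"
    and nz: "\<And>v. c1 v \<noteq> 0 \<or> c2 v \<noteq> 0"
    and det: "\<And>v u w. u \<noteq> w \<Longrightarrow> {v, u} \<in> E \<Longrightarrow> {v, w} \<in> E \<Longrightarrow> det3 c1 c2 c3 v u w \<noteq> 0"
  shows "Var u * Var v \<in> W"
proof -
  have main: "\<forall>t. r t \<le> r v \<longrightarrow> Var v * Var t \<in> W" for v
  proof (induction "Max (range r) - r v" arbitrary: v rule: less_induct)
    case less
    have le: "r t \<le> Max (range r)" for t by simp
    have later: "Var v * Var t \<in> W" if "r v < r t" for t
    proof -
      have "Max (range r) - r t < Max (range r) - r v" using that le[of t] by linarith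
      then show ?thesis using less that by (simp add: mult.commute[of "Var v"])
    qed
    have row: "(\<Sum>t\<in>S. Const (c t) * (Var v * Var t)) \<in> W"
      if "Var v * linear_form c \<in> W" "v \<in> S" "\<And>t. r t < r v \<Longrightarrow> {v, t} \<in> E \<Longrightarrow> t \<in> S" for c S
    proof (rule lin_subspace_linear_form_restrict[OF W that(1)])
      fix t assume t: "t \<notin> S"
      then have "r t \<noteq> r v" using that(2) inj_r by (auto dest: injD)
      then consider "r v < r t" | "r t < r v" by linarith
      then show "Var v * Var t \<in> W"
        by cases (use later that t nonadj[of v t] in auto)
    qed
    show ?case
    proof (cases "v \<in> {x1, x2}")
      case True
      then have "(\<Sum>t\<in>{v}. Const (c t) * (Var v * Var t)) \<in> W" if "Var v * linear_form c \<in> W" for c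
        by (intro row that) (use start in auto)
      from this[OF l(1)] this[OF l(2)] have "Var v * Var v \<in> W"
        using nz[of v] by (auto intro: lin_subspace_Const_cancel[OF W])
      then show ?thesis using start[OF True] nonadj[of v] inj_r
        by (metis injD le_neq_implies_less)
    next
      case False
      then obtain u w where uw: "u \<noteq> w" "r u < r v" "r w < r v" "{v, u} \<in> E" "{v, w} \<in> E"
        "\<And>t. r t < r v \<Longrightarrow> {v, t} \<in> E \<Longrightarrow> t = u \<or> t = w" using two_earlier[OF False] by auto
      have "(\<Sum>t\<in>{v, u, w}. Const (c t) * (Var v * Var t)) \<in> W" if "Var v * linear_form c \<in> W" for c
        by (intro row that) (use uw in auto)
      moreover have "v \<noteq> u" "v \<noteq> w" using uw by auto
      ultimately have rows: "Const (c v) * (Var v * Var v) + Const (c u) * (Var v * Var u) + Const (c w) * (Var v * Var w) \<in> W"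
        if "Var v * linear_form c \<in> W" for c using that uw(1) by (simp add: add.assoc)
      have "Var v * Var v \<in> W" "Var v * Var u \<in> W" "Var v * Var w \<in> W"
        using lin_subspace_solve3[OF W rows[OF l(1)] rows[OF l(2)] rows[OF l(3)]]
          det[OF uw(1,4,5)] unfolding det3_def by blast+
      then show ?thesis using uw(6) nonadj[of v] inj_r
        by (metis injD le_neq_implies_less)
    qed
  qed
  show ?thesis using main[of u] main[of v] nat_le_linear[of "r u" "r v"] by (auto simp: mult.commute)
qed

end

lemma homogeneous_2_mem:
  fixes f :: "('v::finite, 'k::field) mpoly"
  assumes W: "lin_subspace W" "\<And>u v. Var u * Var v \<in> W" and f: "homogeneous 2 f"
  shows "f \<in> W"
proof -
  have "Poly_Mapping.single m c \<in> W" if m: "m \<in> Poly_Mapping.keys f" for m c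
  proof -
    obtain u v where "m = uexp u + uexp v"
      using f m mdeg_2E[of m] unfolding homogeneous_mdeg uexp_def by metis
    then have "Poly_Mapping.single m c = Const c * (Var u * Var v)"
      by (simp add: Const_def Var_uexp mult_single)
    then show ?thesis using lin_subspace_Const[OF W(1) W(2)] by simp
  qed
  then have "(\<Sum>m\<in>Poly_Mapping.keys f. Poly_Mapping.single m (Poly_Mapping.lookup f m)) \<in> W"
    by (intro lin_subspace_sum[OF W(1)])
  then show ?thesis using poly_mapping_sum_singles[of f] by simp
qed

context two_back_graph
begin

text \<open>
  \<open>quadrics_mem\<close> for \<open>W = J + z R\<^sub>1\<close>, where \<open>z\<close> is the linear form with coefficients \<open>c3\<close>.
\<close>

lemma linear_multiples_mod_ideal:
  fixes J :: "('v, 'k::field) mpoly set"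
  assumes J: "ideal J mpoly_ring" and gens: "SR_gens E \<subseteq> J"
    and l: "linear_form c1 \<in> J" "linear_form c2 \<in> J"
    and nz: "\<And>v. c1 v \<noteq> 0 \<or> c2 v \<noteq> 0"
    and det: "\<And>v u w. u \<noteq> w \<Longrightarrow> {v, u} \<in> E \<Longrightarrow> {v, w} \<in> E \<Longrightarrow> det3 c1 c2 c3 v u w \<noteq> 0"
    and f: "homogeneous 2 f"
  shows "\<exists>p. homogeneous 1 p \<and> f - linear_form c3 * p \<in> J"
proof -
  define W where "W = {g. \<exists>p. homogeneous 1 p \<and> g - linear_form c3 * p \<in> J}"
  note sub = lin_subspace_ideal[OF J]
  have mult: "g * f \<in> J" if "f \<in> J" for f g using J that unfolding ideal_type_ring_iff by blast
  have JW: "g \<in> W" if "g \<in> J" for g using that unfolding W_def by (intro CollectI exI[of _ 0]) simp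
  have W: "lin_subspace W"
    unfolding lin_subspace_def
  proof (intro conjI ballI allI)
    show "0 \<in> W" by (intro JW lin_subspace_0[OF sub])
    fix g assume "g \<in> W"
    then obtain p where p: "homogeneous 1 p" "g - linear_form c3 * p \<in> J" by (auto simp: W_def)
    have "Const k * g - linear_form c3 * (Const k * p) \<in> J" for k
      using lin_subspace_Const[OF sub p(2), of k] by (simp add: algebra_simps)
    moreover have "homogeneous 1 (Const k * p)" for k
      using homogeneous_mult[OF homogeneous_Const p(1)] by simp
    ultimately show "Const k * g \<in> W" for k unfolding W_def by blast
    fix h assume "h \<in> W"
    then obtain q where q: "homogeneous 1 q" "h - linear_form c3 * q \<in> J" by (auto simp: W_def)
    have "g + h - linear_form c3 * (p + q) \<in> J"
      using lin_subspace_add[OF sub p(2) q(2)] by (simp add: algebra_simps)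
    then show "g + h \<in> W" using homogeneous_add[OF p(1) q(1)] unfolding W_def by blast
  qed
  have "Var u * Var v \<in> W" for u v
  proof (rule quadrics_mem[OF W])
    fix v
    show "Var v * linear_form c1 \<in> W" "Var v * linear_form c2 \<in> W" by (intro JW mult l)+
    have "Var v * linear_form c3 - linear_form c3 * Var v \<in> J"
      using lin_subspace_0[OF sub] by (simp add: mult.commute)
    then show "Var v * linear_form c3 \<in> W"
      unfolding W_def by (intro CollectI exI[of _ "Var v"] conjI homogeneous_Var)
  next
    show "Var u * Var v \<in> W" if "u \<noteq> v" "{u, v} \<notin> E" for u v
      using JW nonadjacent_mem_SR_gens[OF that] gens by blast
  qed (use nz det in auto)
  then have "f \<in> W" by (rule homogeneous_2_mem[OF W _ f])
  then show ?thesis by (simp add: W_def)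
qed

lemma SR_quot_WLP:
  fixes c1 c2 c3 :: "'v \<Rightarrow> 'k::field"
  assumes nz: "\<And>v. c1 v \<noteq> 0 \<or> c2 v \<noteq> 0"
    and det: "\<And>v u w. u \<noteq> w \<Longrightarrow> {v, u} \<in> E \<Longrightarrow> {v, w} \<in> E \<Longrightarrow> det3 c1 c2 c3 v u w \<noteq> 0"
  shows "SR_quot_WLP E {linear_form c1, linear_form c2}"
proof -
  let ?L = "{linear_form c1, linear_form c2}"
  let ?pi = "SR_quot_class E ?L" and ?R = "SR_quot E ?L"
  let ?z = "linear_form c3"
  have "(\<lambda>x. ?pi ?z \<otimes>\<^bsub>?R\<^esub> x) ` SR_quot_deg E ?L 1 = SR_quot_deg E ?L 2"
  proof (intro equalityI subsetI)
    fix y assume "y \<in> (\<lambda>x. ?pi ?z \<otimes>\<^bsub>?R\<^esub> x) ` SR_quot_deg E ?L 1"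
    then obtain p where "homogeneous 1 p" "y = ?pi (?z * p)"
      by (auto simp: SR_quot_deg_def SR_quot_class_simps)
    then show "y \<in> SR_quot_deg E ?L 2"
      using homogeneous_mult[OF homogeneous_linear_form, of 1 p c3] by (auto simp: SR_quot_deg_def numeral_2_eq_2)
  next
    fix y assume "y \<in> SR_quot_deg E ?L 2"
    then obtain f where f: "homogeneous 2 f" "y = ?pi f" by (auto simp: SR_quot_deg_def)
    obtain p where "homogeneous 1 p" "f - ?z * p \<in> SR_quot_kernel E ?L"
      using linear_multiples_mod_ideal[OF ideal_SR_quot_kernel SR_gens_subset_kernel _ _ nz det f(1)]
        subset_SR_quot_kernel[of ?L E] by auto
    then have "y = ?pi ?z \<otimes>\<^bsub>?R\<^esub> ?pi p" "?pi p \<in> SR_quot_deg E ?L 1"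
      by (auto simp: f(2) SR_quot_deg_def SR_quot_class_simps SR_quot_class_eq_iff)
    then show "y \<in> (\<lambda>x. ?pi ?z \<otimes>\<^bsub>?R\<^esub> x) ` SR_quot_deg E ?L 1" by blast
  qed
  moreover have "?pi ?z \<in> SR_quot_deg E ?L 1"
    unfolding SR_quot_deg_def using homogeneous_linear_form by blast
  ultimately show ?thesis unfolding SR_quot_WLP_def by blast
qed

end


section \<open>Exact zero divisors for bipartite graphs\<close>

lemma lookup_Var:
  "Poly_Mapping.lookup (Var i) 0 = (0 :: 'k::field)"
  "Poly_Mapping.lookup (Var i) (uexp v) = (if i = v then 1 else 0 :: 'k)"
  "Poly_Mapping.lookup (Var i) (uexp u + uexp v) = (0 :: 'k)" for i :: "'i::finite"
proof -
  have "uexp i \<noteq> uexp u + uexp v" by (auto simp: mdeg_add dest!: arg_cong[where f = mdeg])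
  then show "Poly_Mapping.lookup (Var i) 0 = (0 :: 'k)"
    "Poly_Mapping.lookup (Var i) (uexp v) = (if i = v then 1 else 0 :: 'k)"
    "Poly_Mapping.lookup (Var i) (uexp u + uexp v) = (0 :: 'k)"
    by (auto simp: Var_uexp lookup_single when_def)
qed

lemma lookup_linear_form:
  "Poly_Mapping.lookup (linear_form a) 0 = 0"
  "Poly_Mapping.lookup (linear_form a) (uexp v) = a v"
  "Poly_Mapping.lookup (linear_form a) (uexp u + uexp v) = 0"
  by (simp_all add: linear_form_def lookup_sum lookup_Const_mult lookup_Var if_distrib cong: if_cong)

lemma linear_form_restrict_sum: "linear_form (\<lambda>v. if v \<in> A then c v else 0) = (\<Sum>v\<in>A. Const (c v) * Var v)"
  unfolding linear_form_def by (rule sum.mono_neutral_cong_right) auto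

lemma linear_form_Const_mult: "linear_form (\<lambda>v. k * a v) = Const k * linear_form a"
  by (simp add: linear_form_def Const_mult sum_distrib_left mult.assoc)

lemma bipartition_edgeE:
  assumes "bipartition E A B" "e \<in> E"
  obtains x y where "x \<in> A" "y \<in> B" "e = {x, y}"
proof -
  have "\<forall>e\<in>E. \<exists>x\<in>A. \<exists>y\<in>B. e = {x, y}" using assms(1) by (simp add: bipartition_def)
  from bspec[OF this assms(2)] show thesis by (elim bexE) (rule that)
qed

lemma bipartition_sym:
  assumes "bipartition E A B"
  shows "bipartition E B A"
proof -
  have "\<exists>x\<in>B. \<exists>y\<in>A. e = {x, y}" if "e \<in> E" for e
  proof -
    obtain x y where xy: "x \<in> A" "y \<in> B" "e = {x, y}" using bipartition_edgeE[OF assms \<open>e \<in> E\<close>] .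
    then have "e = {y, x}" by auto
    with xy show ?thesis by blast
  qed
  then show ?thesis using assms unfolding bipartition_def by (simp add: Un_commute Int_commute)
qed

lemma bipartition_edge:
  assumes "bipartition E A B" "{u, v} \<in> E"
  shows "u \<in> A \<and> v \<in> B \<or> u \<in> B \<and> v \<in> A"
proof -
  obtain x y where "x \<in> A" "y \<in> B" "{u, v} = {x, y}" using bipartition_edgeE[OF assms] .
  then show ?thesis by (auto simp: doubleton_eq_iff)
qed

text \<open>
  In low degrees these are the conditions satisfied by the elements of the ideal generated by the monomials of
  \<^const>\<open>SR_gens\<close> and \<open>l1, l2\<close>: degree one is spanned by \<open>l1\<close> and \<open>l2\<close>, and in degree two, modulo those monomials and
  squares, the multiples of \<open>l1, l2\<close> by linear forms are the combinations of the sums of all edges at a vertex \<open>w\<close>, with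
  coefficients \<open>s w\<close>.
\<close>

definition bip_ideal :: "'v set set \<Rightarrow> 'v set \<Rightarrow> 'v set \<Rightarrow> ('v, 'k::field) mpoly set" where
  "bip_ideal E A B = {f. Poly_Mapping.lookup f 0 = 0 \<and>
     (\<exists>\<alpha>. \<forall>v\<in>A. Poly_Mapping.lookup f (uexp v) = \<alpha>) \<and> (\<exists>\<beta>. \<forall>v\<in>B. Poly_Mapping.lookup f (uexp v) = \<beta>) \<and>
     (\<exists>s. \<forall>u\<in>A. \<forall>v\<in>B. {u, v} \<in> E \<longrightarrow> Poly_Mapping.lookup f (uexp u + uexp v) = s u + s v)}"

lemma ideal_bip_ideal:
  fixes E :: "'v::finite set set"
  assumes "bipartition E A B"
  shows "ideal (bip_ideal E A B :: ('v, 'k::field) mpoly set) mpoly_ring"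
  unfolding ideal_type_ring_iff
proof (intro conjI ballI allI)
  have disj: "A \<inter> B = {}" using assms by (simp add: bipartition_def)
  show "0 \<in> (bip_ideal E A B :: ('v, 'k) mpoly set)"
    unfolding bip_ideal_def by (auto intro!: exI[of _ "\<lambda>_. 0"])
  fix f :: "('v, 'k) mpoly" assume "f \<in> bip_ideal E A B"
  then obtain \<alpha> \<beta> s where f: "Poly_Mapping.lookup f 0 = 0" "\<And>v. v \<in> A \<Longrightarrow> Poly_Mapping.lookup f (uexp v) = \<alpha>"
    "\<And>v. v \<in> B \<Longrightarrow> Poly_Mapping.lookup f (uexp v) = \<beta>"
    "\<And>u v. u \<in> A \<Longrightarrow> v \<in> B \<Longrightarrow> {u, v} \<in> E \<Longrightarrow> Poly_Mapping.lookup f (uexp u + uexp v) = s u + s v"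
    unfolding bip_ideal_def by blast
  {
    fix g :: "('v, 'k) mpoly" assume "g \<in> bip_ideal E A B"
    then obtain \<alpha>' \<beta>' s' where g: "Poly_Mapping.lookup g 0 = 0" "\<And>v. v \<in> A \<Longrightarrow> Poly_Mapping.lookup g (uexp v) = \<alpha>'"
      "\<And>v. v \<in> B \<Longrightarrow> Poly_Mapping.lookup g (uexp v) = \<beta>'"
      "\<And>u v. u \<in> A \<Longrightarrow> v \<in> B \<Longrightarrow> {u, v} \<in> E \<Longrightarrow> Poly_Mapping.lookup g (uexp u + uexp v) = s' u + s' v"
      unfolding bip_ideal_def by blast
    show "f + g \<in> bip_ideal E A B"
      unfolding bip_ideal_def
      by (intro CollectI conjI exI[of _ "\<alpha> + \<alpha>'"] exI[of _ "\<beta> + \<beta>'"] exI[of _ "\<lambda>v. s v + s' v"])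
         (simp_all add: lookup_add f g)
  }
  fix g :: "('v, 'k) mpoly"
  let ?g0 = "Poly_Mapping.lookup g 0"
  let ?s = "\<lambda>w. ?g0 * s w + Poly_Mapping.lookup g (uexp w) * (if w \<in> A then \<beta> else \<alpha>)"
  have "Poly_Mapping.lookup (g * f) (uexp u + uexp v) = ?s u + ?s v"
    if "u \<in> A" "v \<in> B" "{u, v} \<in> E" for u v
  proof -
    have "u \<noteq> v" "v \<notin> A" using that disj by auto
    then show ?thesis using that by (simp add: lookup_mult_2 f algebra_simps)
  qed
  then show "g * f \<in> bip_ideal E A B"
    unfolding bip_ideal_def
    by (intro CollectI conjI exI[of _ "?g0 * \<alpha>"] exI[of _ "?g0 * \<beta>"] exI[of _ ?s])
       (simp_all add: lookup_mult_0 lookup_mult_1 f)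
qed

lemma SR_quot_kernel_bipartite:
  fixes E :: "'v::finite set set"
  assumes bip: "bipartition E A B"
  shows "SR_quot_kernel E {\<Sum>x\<in>A. Var x, \<Sum>y\<in>B. Var y} \<subseteq> (bip_ideal E A B :: ('v, 'k::field) mpoly set)"
proof (rule SR_quot_kernel_minimal[OF ideal_bip_ideal[OF bip]])
  have disj: "A \<inter> B = {}" using assms by (simp add: bipartition_def)
  have linear: "linear_form c \<in> (bip_ideal E A B :: ('v, 'k) mpoly set)"
    if "\<And>v. v \<in> A \<Longrightarrow> c v = \<alpha>" "\<And>v. v \<in> B \<Longrightarrow> c v = \<beta>" for c \<alpha> \<beta>
    unfolding bip_ideal_def using that
    by (intro CollectI conjI exI[of _ \<alpha>] exI[of _ \<beta>] exI[of _ "\<lambda>_. 0"])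
       (simp_all add: lookup_linear_form)
  have "(\<Sum>x\<in>A. Var x) \<in> (bip_ideal E A B :: ('v, 'k) mpoly set)"
  proof -
    have "linear_form (\<lambda>v. if v \<in> A then 1 else 0) \<in> (bip_ideal E A B :: ('v, 'k) mpoly set)"
      by (rule linear[of _ 1 0]) (use disj in auto)
    then show ?thesis using linear_form_restrict_sum[of A "\<lambda>_. 1 :: 'k"] by simp
  qed
  moreover have "(\<Sum>x\<in>B. Var x) \<in> (bip_ideal E A B :: ('v, 'k) mpoly set)"
  proof -
    have "linear_form (\<lambda>v. if v \<in> B then 1 else 0) \<in> (bip_ideal E A B :: ('v, 'k) mpoly set)"
      by (rule linear[of _ 0 1]) (use disj in auto)
    then show ?thesis using linear_form_restrict_sum[of B "\<lambda>_. 1 :: 'k"] by simp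
  qed
  ultimately show "{\<Sum>x\<in>A. Var x, \<Sum>y\<in>B. Var y} \<subseteq> (bip_ideal E A B :: ('v, 'k) mpoly set)" by simp
  show "SR_gens E \<subseteq> (bip_ideal E A B :: ('v, 'k) mpoly set)"
  proof
    fix f :: "('v, 'k) mpoly" assume "f \<in> SR_gens E"
    then have low: "Poly_Mapping.lookup f 0 = 0" "Poly_Mapping.lookup f (uexp v) = 0" for v
      by (auto simp: SR_gens_def lookup_mult_0 lookup_mult_1 lookup_Var)
    have "Poly_Mapping.lookup f (uexp u + uexp v) = 0" if uv: "u \<in> A" "v \<in> B" "{u, v} \<in> E" for u v
    proof -
      have "u \<noteq> v" using uv disj by auto
      from \<open>f \<in> SR_gens E\<close> consider i j where "f = Var i * Var j" "{i, j} \<notin> E"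
        | i j m where "f = Var i * Var j * Var m" unfolding SR_gens_def by blast
      then show ?thesis
      proof cases
        case 1
        have "\<not> (i = u \<and> j = v)" "\<not> (i = v \<and> j = u)" using 1(2) uv(3) by (auto simp: insert_commute)
        then show ?thesis
          unfolding 1(1) lookup_mult_2[OF \<open>u \<noteq> v\<close>] by (simp add: lookup_Var)
      next
        case 2
        show ?thesis
          unfolding 2 lookup_mult_2[OF \<open>u \<noteq> v\<close>] by (simp add: lookup_Var lookup_mult_0 lookup_mult_1)
      qed
    qed
    then show "f \<in> bip_ideal E A B"
      unfolding bip_ideal_def
      by (intro CollectI conjI exI[of _ 0] exI[of _ "\<lambda>_. 0"]) (simp_all add: low)
  qed
qed

context two_back_graph
begin

text \<open>
  At a vertex \<open>v\<close> with earlier neighbours \<open>u\<close> and \<open>w\<close>, where the solution already vanishes, the equations read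
  \<open>d v * c u = s v = d v * c w\<close>, and \<open>c u \<noteq> c w\<close>.
\<close>

lemma edge_equations_trivial:
  fixes c d s :: "'v \<Rightarrow> 'k::field"
  assumes eq: "\<And>u v. {u, v} \<in> E \<Longrightarrow> d u * c v + d v * c u = s u + s v"
    and c: "\<And>v u w. u \<noteq> w \<Longrightarrow> {v, u} \<in> E \<Longrightarrow> {v, w} \<in> E \<Longrightarrow> c u \<noteq> c w"
    and start0: "\<And>v. v \<in> {x1, x2} \<Longrightarrow> d v = 0 \<and> s v = 0"
  shows "d v = 0 \<and> s v = 0"
proof (induction "r v" arbitrary: v rule: less_induct)
  case less
  show ?case
  proof (cases "v \<in> {x1, x2}")
    case False
    then obtain u w where uw: "u \<noteq> w" "r u < r v" "r w < r v" "{v, u} \<in> E" "{v, w} \<in> E"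
      using two_earlier by metis
    have "d u = 0" "s u = 0" "d w = 0" "s w = 0" using less uw by auto
    then have "d v * c u = s v" "d v * c w = s v" using eq[OF uw(4)] eq[OF uw(5)] by auto
    then have "d v * (c u - c w) = 0" by (simp add: algebra_simps)
    then have "d v = 0" using c[OF uw(1,4,5)] by simp
    then show ?thesis using \<open>d v * c u = s v\<close> by simp
  qed (rule start0)
qed

text \<open>
  The obvious solutions come from \<open>z\<close> constant on one side, from \<open>s\<close> equal to opposite constants on the two sides, and from
  \<open>z = \<plusminus> c\<close>. They form a space of dimension four, and since \<open>c\<close> separates \<open>x1\<close> and \<open>x2\<close> there is one with the given
  values of \<open>z\<close> and \<open>s\<close> at these two vertices; the difference to it is zero.
\<close>

lemma edge_equations_solution_start_left:
  fixes c z s :: "'v \<Rightarrow> 'k::field"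
  assumes bip: "bipartition E A B" and x1: "x1 \<in> A"
    and c: "inj_on c A" "inj_on c B"
    and eq: "\<And>u v. {u, v} \<in> E \<Longrightarrow> z u * c v + z v * c u = s u + s v"
  shows "\<exists>\<rho> \<mu> \<kappa>. (\<forall>v\<in>A. z v = \<rho> + \<kappa> * c v) \<and> (\<forall>v\<in>B. z v = \<mu> - \<kappa> * c v)"
proof -
  have disj: "v \<in> A \<Longrightarrow> v \<notin> B" for v using bip by (auto simp: bipartition_def)
  obtain y where y: "{x1, y} \<in> E" "{x2, y} \<in> E" using common by auto
  have x2: "x2 \<in> A" using bipartition_edge[OF bip y(1)] bipartition_edge[OF bip y(2)] x1 disj by blast
  then have ne: "c x1 - c x2 \<noteq> 0" using x1 c(1) start_distinct by (auto dest: inj_onD)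
  \<comment> \<open>The two pairs of equations for the values at \<open>x1\<close> and \<open>x2\<close> are solved by interpolation.\<close>
  define \<kappa> where "\<kappa> = (z x1 - z x2) / (c x1 - c x2)"
  define \<rho> where "\<rho> = z x1 - \<kappa> * c x1"
  define \<mu> where "\<mu> = (s x1 - s x2) / (c x1 - c x2)"
  define \<nu> where "\<nu> = s x1 - \<mu> * c x1"
  define z' where "z' v = (if v \<in> A then \<rho> + \<kappa> * c v else \<mu> - \<kappa> * c v)" for v
  define s' where "s' v = (if v \<in> A then \<mu> * c v + \<nu> else \<rho> * c v - \<nu>)" for v
  have eq': "z' u * c v + z' v * c u = s' u + s' v" if "{u, v} \<in> E" for u v
    using bipartition_edge[OF bip that] disj by (auto simp: z'_def s'_def algebra_simps)
  have k: "\<kappa> * (c x1 - c x2) = z x1 - z x2" "\<mu> * (c x1 - c x2) = s x1 - s x2"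
    using ne by (simp_all add: \<kappa>_def \<mu>_def)
  have "z x1 = z' x1" "s x1 = s' x1" using x1 by (simp_all add: z'_def s'_def \<rho>_def \<nu>_def)
  moreover have "z x2 = z' x2" "s x2 = s' x2"
    using k x2 by (simp_all add: z'_def s'_def \<rho>_def \<nu>_def algebra_simps)
  ultimately have start0: "z v - z' v = 0 \<and> s v - s' v = 0" if "v \<in> {x1, x2}" for v
    using that by auto
  have diff: "(z u - z' u) * c v + (z v - z' v) * c u = (s u - s' u) + (s v - s' v)" if "{u, v} \<in> E" for u v
    using eq[OF that] eq'[OF that] by (simp add: algebra_simps)
  have sep: "c u \<noteq> c w" if "u \<noteq> w" "{v, u} \<in> E" "{v, w} \<in> E" for v u w
    using c bipartition_edge[OF bip that(2)] bipartition_edge[OF bip that(3)] disj that(1)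
    by (auto dest: inj_onD)
  have "z v - z' v = 0 \<and> s v - s' v = 0" for v
    by (rule edge_equations_trivial[of "\<lambda>v. z v - z' v" c "\<lambda>v. s v - s' v", OF diff sep start0])
  then have "z v = z' v" for v by simp
  then show ?thesis using disj
    by (intro exI[of _ \<rho>] exI[of _ \<mu>] exI[of _ \<kappa>]) (auto simp: z'_def)
qed

lemma edge_equations_solution:
  fixes c z s :: "'v \<Rightarrow> 'k::field"
  assumes bip: "bipartition E A B" and c: "inj_on c A" "inj_on c B"
    and eq: "\<And>u v. {u, v} \<in> E \<Longrightarrow> z u * c v + z v * c u = s u + s v"
  shows "\<exists>\<rho> \<mu> \<kappa>. (\<forall>v\<in>A. z v = \<rho> + \<kappa> * c v) \<and> (\<forall>v\<in>B. z v = \<mu> - \<kappa> * c v)"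
proof (cases "x1 \<in> A")
  case True
  from edge_equations_solution_start_left[OF bip True c eq] show ?thesis .
next
  case False
  then have "x1 \<in> B" using bip by (auto simp: bipartition_def)
  from edge_equations_solution_start_left[OF bipartition_sym[OF bip] this c(2,1) eq]
  obtain \<rho> \<mu> \<kappa> where "\<forall>v\<in>B. z v = \<rho> + \<kappa> * c v" "\<forall>v\<in>A. z v = \<mu> - \<kappa> * c v" by blast
  then show ?thesis by (intro exI[of _ \<mu>] exI[of _ \<rho>] exI[of _ "- \<kappa>"]) auto
qed

text \<open>
  For a vertex on one side and two neighbours on the other the determinant reduces to the difference \<open>\<plusminus> (c u - c w)\<close>.
\<close>

lemma bipartite_nbrs_det3:
  fixes c :: "'v \<Rightarrow> 'k::field"
  assumes bip: "bipartition E A B" and c: "inj_on c A" "inj_on c B"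
    and vuw: "u \<noteq> w" "{v, u} \<in> E" "{v, w} \<in> E"
  shows "det3 (\<lambda>v. if v \<in> A then 1 else 0) (\<lambda>v. if v \<in> B then 1 else 0) c v u w \<noteq> 0"
proof -
  have disj: "A \<inter> B = {}" using bip by (auto simp: bipartition_def)
  from bipartition_edge[OF bip vuw(2)] bipartition_edge[OF bip vuw(3)] disj
  consider "v \<in> A" "u \<in> B" "w \<in> B" | "v \<in> B" "u \<in> A" "w \<in> A" by blast
  then show ?thesis
  proof cases
    case 1
    then have "v \<notin> B" "u \<notin> A" "w \<notin> A" "c u \<noteq> c w" using disj c vuw(1) by (auto dest: inj_onD)
    then show ?thesis using 1 by (simp add: det3_def)
  next
    case 2
    then have "v \<notin> A" "u \<notin> B" "w \<notin> B" "c u \<noteq> c w" using disj c vuw(1) by (auto dest: inj_onD)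
    then show ?thesis using 2 by (simp add: det3_def)
  qed
qed

text \<open>
  If \<open>f = k + z + q\<close> in the normal form by degrees, then \<open>f c = k c + z c\<close> since cubic monomials vanish. The degree one part
  forces \<open>k = 0\<close>, because \<open>c\<close> is not constant on the side of \<open>x1\<close> and \<open>x2\<close>; the degree two part forces \<open>z\<close> to be
  a scalar multiple of \<open>\<beta>\<close>, by \<open>edge_equations_solution\<close>; and \<open>q\<close> is a multiple of \<open>\<beta>\<close> by
  \<open>linear_multiples_mod_ideal\<close>.
\<close>

lemma bipartite_annihilator:
  fixes c :: "'v \<Rightarrow> 'k::field"
  assumes bip: "bipartition E A B" and c: "inj_on c A" "inj_on c B"
  defines "J \<equiv> SR_quot_kernel E {\<Sum>x\<in>A. Var x, \<Sum>y\<in>B. Var y}"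
  defines "\<beta> \<equiv> linear_form (\<lambda>v. if v \<in> A then c v else - c v)"
  shows "f * linear_form c \<in> J \<longleftrightarrow> (\<exists>g. f - g * \<beta> \<in> J)"
proof -
  have J: "ideal J mpoly_ring" unfolding J_def by (rule ideal_SR_quot_kernel)
  note sub = lin_subspace_ideal[OF J]
  have mult: "g * h \<in> J" if "h \<in> J" for g h using J that unfolding ideal_type_ring_iff by blast
  have gens: "SR_gens E \<subseteq> J" unfolding J_def by (rule SR_gens_subset_kernel)
  have AB: "A \<union> B = UNIV" "A \<inter> B = {}" using bip by (auto simp: bipartition_def)
  let ?a = "\<lambda>v. if v \<in> A then 1 else 0 :: 'k" and ?b = "\<lambda>v. if v \<in> B then 1 else 0 :: 'k"
  have la: "linear_form ?a = (\<Sum>x\<in>A. Var x)" "linear_form ?b = (\<Sum>x\<in>B. Var x)"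
    using linear_form_restrict_sum[of A "\<lambda>_. 1 :: 'k"] linear_form_restrict_sum[of B "\<lambda>_. 1 :: 'k"] by simp_all
  have l: "linear_form ?a \<in> J" "linear_form ?b \<in> J"
    using subset_SR_quot_kernel[of "{\<Sum>x\<in>A. Var x, \<Sum>y\<in>B. Var y} :: ('v, 'k) mpoly set" E]
    unfolding la J_def by auto
  have nz: "?a v \<noteq> 0 \<or> ?b v \<noteq> 0" for v using AB by auto
  have cubic: "Var u * Var v * Var w \<in> J" for u v w
    by (rule cubic_mem_ideal[OF J gens l _ nz])
       (use AB bipartition_edge[OF bip] in \<open>fastforce simp: disjoint_iff\<close>)
  \<comment> \<open>Off the diagonal these products are generators, and \<open>T\<^sub>u\<^sup>2\<close> is \<open>T\<^sub>u\<close> times the sum of its side.\<close>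
  have side: "(\<Sum>v\<in>S. Const (d v) * Var v) * (\<Sum>v\<in>S. Const (d v) * Var v) \<in> J"
    if S: "S = A \<or> S = B" for S and d :: "'v \<Rightarrow> 'k"
  proof -
    have non: "Var u * Var v \<in> J" if "u \<in> S" "v \<in> S" "u \<noteq> v" for u v
    proof -
      have "{u, v} \<notin> E" using bipartition_edge[OF bip, of u v] S that AB(2) by blast
      then show ?thesis using nonadjacent_mem_SR_gens[OF that(3)] gens by blast
    qed
    have sq: "Var u * Var u \<in> J" if "u \<in> S" for u
    proof -
      have "(\<Sum>v\<in>S. Var v) \<in> J" using S l unfolding la by auto
      then have "Var u * (\<Sum>v\<in>S. Var v) \<in> J" by (rule mult)
      also have "Var u * (\<Sum>v\<in>S. Var v) = Var u * Var u + (\<Sum>v\<in>S-{u}. Var u * Var v)"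
        using that by (subst sum.remove[of S u]) (auto simp: distrib_left sum_distrib_left)
      finally have "Var u * Var u + (\<Sum>v\<in>S-{u}. Var u * Var v) \<in> J" .
      moreover have "(\<Sum>v\<in>S-{u}. Var u * Var v) \<in> J"
        by (intro lin_subspace_sum[OF sub]) (use non that in auto)
      ultimately show ?thesis using lin_subspace_diff[OF sub] by fastforce
    qed
    have "(\<Sum>v\<in>S. Const (d v) * Var v) * (\<Sum>v\<in>S. Const (d v) * Var v) =
      (\<Sum>u\<in>S. \<Sum>v\<in>S. Const (d u * d v) * (Var u * Var v))"
      by (simp add: sum_product Const_mult mult_ac)
    also have "\<dots> \<in> J"
    proof (intro lin_subspace_sum[OF sub] lin_subspace_Const[OF sub])
      fix u v assume "u \<in> S" "v \<in> S"
      then show "Var u * Var v \<in> J" using sq non by (cases "u = v") auto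
    qed
    finally show ?thesis .
  qed
  define fA where "fA = (\<Sum>v\<in>A. Const (c v) * Var v)"
  define fB where "fB = (\<Sum>v\<in>B. Const (c v) * Var v)"
  have split: "linear_form d = (\<Sum>v\<in>A. Const (d v) * Var v) + (\<Sum>v\<in>B. Const (d v) * Var v)" for d :: "'v \<Rightarrow> 'k"
    unfolding linear_form_def AB(1)[symmetric] by (rule sum.union_disjoint) (use AB(2) in auto)
  have \<alpha>: "linear_form c = fA + fB" unfolding fA_def fB_def by (rule split)
  have "(\<Sum>v\<in>B. Const (if v \<in> A then c v else - c v) * Var v) = - fB"
    unfolding fB_def sum_negf[symmetric] by (rule sum.cong) (use AB(2) in \<open>auto simp: Const_minus\<close>)
  then have \<beta>: "\<beta> = fA - fB" unfolding \<beta>_def split fA_def by simp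
  have "\<beta> * linear_form c = fA * fA - fB * fB" unfolding \<alpha> \<beta> by (simp add: algebra_simps)
  then have prod: "\<beta> * linear_form c \<in> J"
    using side[of A c] side[of B c] lin_subspace_diff[OF sub] by (simp add: fA_def fB_def)
  show ?thesis
  proof
    assume "\<exists>g. f - g * \<beta> \<in> J"
    then obtain g where "f - g * \<beta> \<in> J" ..
    then have "linear_form c * (f - g * \<beta>) + g * (\<beta> * linear_form c) \<in> J"
      using mult prod by (intro lin_subspace_add[OF sub])
    then show "f * linear_form c \<in> J" by (simp add: algebra_simps)
  next
    assume f: "f * linear_form c \<in> J"
    obtain k z b where nf: "f - (Const k + linear_form z + quad_form b) \<in> J"
      using degree_two_normal_form[OF J cubic] by blast
    have q: "linear_form c * quad_form b \<in> J"
    proof -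
      have "linear_form c * quad_form b = (\<Sum>v\<in>UNIV. Const (c v) * (Var v * quad_form b))"
        by (simp add: linear_form_def sum_distrib_right mult.assoc)
      also have "\<dots> \<in> J" using Var_mult_quad_form_mem[OF J cubic]
        by (intro lin_subspace_sum[OF sub] lin_subspace_Const[OF sub])
      finally show ?thesis .
    qed
    have "f * linear_form c - linear_form c * (f - (Const k + linear_form z + quad_form b)) 
        - linear_form c * quad_form b \<in> J"
      by (intro lin_subspace_diff[OF sub] f q mult nf)
    then have "Const k * linear_form c + linear_form z * linear_form c \<in> J"
      by (simp add: algebra_simps)
    then have mem: "Const k * linear_form c + linear_form z * linear_form c \<in> bip_ideal E A B"
      using SR_quot_kernel_bipartite[OF bip] unfolding J_def by blast
    obtain p q s where pqs: "\<And>v. v \<in> A \<Longrightarrow> k * c v = p" "\<And>v. v \<in> B \<Longrightarrow> k * c v = q"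
      "\<And>u v. u \<in> A \<Longrightarrow> v \<in> B \<Longrightarrow> {u, v} \<in> E \<Longrightarrow> z u * c v + z v * c u = s u + s v"
    proof -
      have "Poly_Mapping.lookup (Const k * linear_form c + linear_form z * linear_form c) (uexp v) = k * c v" for v
        unfolding lookup_add lookup_Const_mult by (simp add: lookup_mult_1 lookup_linear_form)
      moreover have "Poly_Mapping.lookup (Const k * linear_form c + linear_form z * linear_form c) (uexp u + uexp v)
        = z u * c v + z v * c u" if "u \<in> A" "v \<in> B" for u v
      proof -
        have "u \<noteq> v" using that AB(2) by auto
        then show ?thesis
          unfolding lookup_add lookup_Const_mult by (simp add: lookup_mult_2 lookup_linear_form)
      qed
      ultimately show ?thesis using mem that unfolding bip_ideal_def by auto
    qed
    have eq: "z u * c v + z v * c u = s u + s v" if "{u, v} \<in> E" for u v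
      using bipartition_edge[OF bip that] pqs(3)[of u v] pqs(3)[of v u] that
      by (auto simp: insert_commute add.commute)
    obtain y where "{x1, y} \<in> E" "{x2, y} \<in> E" using common by auto
    then have same: "x1 \<in> A \<and> x2 \<in> A \<or> x1 \<in> B \<and> x2 \<in> B"
      using bipartition_edge[OF bip] AB(2) by blast
    then have "k * (c x1 - c x2) = 0"
      using pqs(1)[of x1] pqs(1)[of x2] pqs(2)[of x1] pqs(2)[of x2] by (auto simp: algebra_simps)
    moreover have "c x1 \<noteq> c x2" using same c start_distinct by (auto dest: inj_onD)
    ultimately have "k = 0" by simp
    obtain \<rho> \<mu> \<kappa> where sol: "\<forall>v\<in>A. z v = \<rho> + \<kappa> * c v" "\<forall>v\<in>B. z v = \<mu> - \<kappa> * c v"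
      using edge_equations_solution[OF bip c eq] by blast
    have "z = (\<lambda>v. (\<rho> * ?a v + \<mu> * ?b v) + \<kappa> * (if v \<in> A then c v else - c v))"
    proof
      fix v show "z v = (\<rho> * ?a v + \<mu> * ?b v) + \<kappa> * (if v \<in> A then c v else - c v)"
        using sol AB by (cases "v \<in> A") auto
    qed
    then have "linear_form z = Const \<rho> * linear_form ?a + Const \<mu> * linear_form ?b + Const \<kappa> * \<beta>"
      unfolding \<beta>_def linear_form_Const_mult[symmetric] linear_form_add[symmetric] by simp
    then have z: "linear_form z - Const \<kappa> * \<beta> \<in> J"
      using l by (simp add: lin_subspace_add[OF sub] lin_subspace_Const[OF sub])
    have "homogeneous 2 (quad_form b)"
      unfolding quad_form_def using homogeneous_mult[OF homogeneous_Const homogeneous_mult[OF homogeneous_Var homogeneous_Var]]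
      by (intro homogeneous_sum) (simp add: numeral_2_eq_2)
    moreover have "inj_on (\<lambda>v. if v \<in> A then c v else - c v) A" "inj_on (\<lambda>v. if v \<in> A then c v else - c v) B"
      using c AB(2) by (auto simp: inj_on_def disjoint_iff)
    ultimately obtain p where "quad_form b - \<beta> * p \<in> J"
      using linear_multiples_mod_ideal[OF J gens l nz bipartite_nbrs_det3[OF bip]] unfolding \<beta>_def by blast
    then have "(f - (Const k + linear_form z + quad_form b)) + (linear_form z - Const \<kappa> * \<beta>) + (quad_form b - \<beta> * p) \<in> J"
      by (intro lin_subspace_add[OF sub] nf z)
    then have "f - (Const \<kappa> + p) * \<beta> \<in> J" using \<open>k = 0\<close> by (simp add: algebra_simps)
    then show "\<exists>g. f - g * \<beta> \<in> J" by blast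
  qed
qed

lemma bipartite_exact_zero_divisors:
  fixes c :: "'v \<Rightarrow> 'k::field"
  assumes bip: "bipartition E A B" and c: "inj_on c A" "inj_on c B"
  defines "L \<equiv> {\<Sum>x\<in>A. Var x, \<Sum>y\<in>B. Var y} :: ('v, 'k) mpoly set"
  defines "c' \<equiv> \<lambda>v. if v \<in> A then c v else - c v"
  shows "exact_zero_divisors (SR_quot E L) (SR_quot_class E L (linear_form c)) (SR_quot_class E L (linear_form c'))"
proof -
  let ?R = "SR_quot E L" and ?pi = "SR_quot_class E L"
  have AB: "A \<inter> B = {}" using bip by (auto simp: bipartition_def)
  have ann: "Ann ?R (?pi (linear_form d)) = PIdl\<^bsub>?R\<^esub> (?pi (linear_form (\<lambda>v. if v \<in> A then d v else - d v)))"
    if d: "inj_on d A" "inj_on d B" for d :: "'v \<Rightarrow> 'k"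
  proof -
    let ?d = "linear_form (\<lambda>v. if v \<in> A then d v else - d v)"
    have iff: "?pi f \<otimes>\<^bsub>?R\<^esub> ?pi (linear_form d) = \<zero>\<^bsub>?R\<^esub> \<longleftrightarrow> (\<exists>g. ?pi f = ?pi g \<otimes>\<^bsub>?R\<^esub> ?pi ?d)" for f
      using bipartite_annihilator[OF bip d, of f] unfolding L_def[symmetric]
      by (simp add: SR_quot_class_simps SR_quot_class_eq_iff SR_quot_kernel_def[of E L])
    show ?thesis
    proof (intro equalityI subsetI)
      fix x assume "x \<in> Ann ?R (?pi (linear_form d))"
      then obtain f where f: "x = ?pi f" "?pi f \<otimes>\<^bsub>?R\<^esub> ?pi (linear_form d) = \<zero>\<^bsub>?R\<^esub>"
        unfolding Ann_def SR_quot_presentation(3) by blast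
      then obtain g where "?pi f = ?pi g \<otimes>\<^bsub>?R\<^esub> ?pi ?d" using iff by blast
      then show "x \<in> PIdl\<^bsub>?R\<^esub> (?pi ?d)"
        unfolding cgenideal_def SR_quot_presentation(3) f(1) by blast
    next
      fix x assume "x \<in> PIdl\<^bsub>?R\<^esub> (?pi ?d)"
      then obtain g where x: "x = ?pi g \<otimes>\<^bsub>?R\<^esub> ?pi ?d" 
        unfolding cgenideal_def SR_quot_presentation(3) by blast
      then have "x = ?pi (g * ?d)" by (simp add: SR_quot_class_simps)
      then show "x \<in> Ann ?R (?pi (linear_form d))"
        using iff[of "g * ?d"] x unfolding Ann_def SR_quot_presentation(3) by blast
    qed
  qed
  have unit: "?pi (linear_form d) \<notin> Units ?R" for d
  proof
    assume "?pi (linear_form d) \<in> Units ?R"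
    then obtain f where "?pi f \<otimes>\<^bsub>?R\<^esub> ?pi (linear_form d) = \<one>\<^bsub>?R\<^esub>"
      unfolding Units_def SR_quot_presentation(3) by auto
    then have "f * linear_form d - 1 \<in> SR_quot_kernel E L"
      by (simp add: SR_quot_class_simps SR_quot_class_eq_iff)
    then have "f * linear_form d - 1 \<in> bip_ideal E A B"
      using SR_quot_kernel_bipartite[OF bip] unfolding L_def by blast
    then have "Poly_Mapping.lookup (f * linear_form d - 1) 0 = 0" by (simp add: bip_ideal_def)
    then show False by (simp add: lookup_minus lookup_mult_0 lookup_linear_form)
  qed
  have "inj_on c' A" "inj_on c' B" using c AB by (auto simp: c'_def inj_on_def disjoint_iff)
  from ann[OF c] ann[OF this] have
    "Ann ?R (?pi (linear_form c)) = PIdl\<^bsub>?R\<^esub> (?pi (linear_form c'))"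
    "Ann ?R (?pi (linear_form c')) = PIdl\<^bsub>?R\<^esub> (?pi (linear_form c))"
    by (simp_all add: c'_def if_distrib cong: if_cong)
  then show ?thesis
    unfolding exact_zero_divisors_def by (simp add: unit SR_quot_class_simps)
qed

end


section \<open>The genericity condition\<close>

text \<open>
  The sets of edges from \<open>xs i\<close> back to earlier vertices, for \<open>i \<ge> 3\<close>, are disjoint and have at least two elements, so they
  account for \<open>2 (n - 2)\<close> edges. As this is the number of all edges, each set has exactly two elements and no edge is
  left over for \<open>{xs 1, xs 2}\<close>. The case \<open>n = 2\<close> would require a connected graph without edges.
\<close>

lemma two_back_graph_if_ordering:
  fixes E :: "'v::finite set set" and xs :: "nat \<Rightarrow> 'v"
  assumes simple: "simple_graph E" and conn: "connected_graph E"
    and cardE: "int (card E) = 2 * int CARD('v) - 4"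
    and bij: "bij_betw xs {1..CARD('v)} UNIV"
    and two: "\<forall>i\<in>{3..CARD('v)}. card {e\<in>E. \<exists>j\<in>{1..<i}. e = {xs i, xs j}} \<ge> 2"
  shows "two_back_graph E (inv_into {1..CARD('v)} xs) (xs 1) (xs 2)"
proof -
  let ?n = "CARD('v)"
  define r where "r = inv_into {1..?n} xs"
  define D where "D i = {e\<in>E. \<exists>j\<in>{1..<i}. e = {xs i, xs j}}" for i
  have inj: "inj_on xs {1..?n}" using bij by (rule bij_betw_imp_inj_on)
  have xs_eq: "xs i = xs j \<longleftrightarrow> i = j" if "i \<in> {1..?n}" "j \<in> {1..?n}" for i j
    using inj that by (auto dest: inj_onD)
  have r: "r v \<in> {1..?n}" "xs (r v) = v" for v
  proof -
    have "v \<in> xs ` {1..?n}" using bij by (simp add: bij_betw_def)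
    then show "r v \<in> {1..?n}" "xs (r v) = v" unfolding r_def by (rule inv_into_into, rule f_inv_into_f)
  qed
  have r_xs: "r (xs i) = i" if "i \<in> {1..?n}" for i
    unfolding r_def by (rule inv_into_f_f[OF inj that])
  have n3: "?n \<ge> 3"
  proof (rule ccontr)
    assume "\<not> ?n \<ge> 3"
    then have "?n = 2" and "card E = 0" using cardE by linarith+
    then have "E = {}" by simp
    then have "{(a, b). {a, b} \<in> E} = {}" by simp
    then have "u = v" for u v :: 'v using conn unfolding connected_graph_def by simp
    then have "xs 1 = xs 2" .
    then show False using xs_eq[of 1 2] \<open>?n = 2\<close> by simp
  qed
  have disj: "D i \<inter> D i' = {}" if "i < i'" "i \<in> {3..?n}" "i' \<in> {3..?n}" for i i'
  proof (rule ccontr)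
    assume "D i \<inter> D i' \<noteq> {}"
    then obtain e where e: "e \<in> D i" "e \<in> D i'" by blast
    obtain j where j: "j \<in> {1..<i}" "e = {xs i, xs j}" using e(1) unfolding D_def by blast
    moreover obtain j' where "e = {xs i', xs j'}" using e(2) unfolding D_def by blast
    ultimately have "xs i' = xs i \<or> xs i' = xs j" by (auto simp: doubleton_eq_iff)
    then show False using xs_eq[of i' i] xs_eq[of i' j] j that by auto
  qed
  have "card (\<Union>i\<in>{3..?n}. D i) = (\<Sum>i\<in>{3..?n}. card (D i))"
  proof (rule card_UN_disjoint)
    show "\<forall>i\<in>{3..?n}. \<forall>j\<in>{3..?n}. i \<noteq> j \<longrightarrow> D i \<inter> D j = {}"
      using disj by (metis Int_commute linorder_neqE_nat)
  qed auto
  moreover have "card (\<Union>i\<in>{3..?n}. D i) \<le> card E" by (rule card_mono) (auto simp: D_def)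
  moreover have "(\<Sum>i\<in>{3..?n}. (2::nat)) = card E" using cardE n3 by simp
  moreover have le: "2 \<le> card (D i)" if "i \<in> {3..?n}" for i using two that by (simp add: D_def)
  then have "(\<Sum>i\<in>{3..?n}. 2) \<le> (\<Sum>i\<in>{3..?n}. card (D i))" by (rule sum_mono)
  ultimately have sum: "(\<Sum>i\<in>{3..?n}. card (D i)) = (\<Sum>i\<in>{3..?n}. 2)"
    and cardU: "card (\<Union>i\<in>{3..?n}. D i) = card E" by linarith+
  have two': "card (D i) = 2" if "i \<in> {3..?n}" for i
  proof (rule ccontr)
    assume "card (D i) \<noteq> 2"
    then have "2 < card (D i)" using le[OF that] by simp
    then have "(\<Sum>i\<in>{3..?n}. 2) < (\<Sum>i\<in>{3..?n}. card (D i))"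
      using le that by (intro sum_strict_mono_ex1) auto
    then show False using sum by simp
  qed
  have U: "(\<Union>i\<in>{3..?n}. D i) = E"
    by (rule card_subset_eq) (use cardU in \<open>auto simp: D_def\<close>)
  have x12: "{xs 1, xs 2} \<notin> E"
  proof
    assume "{xs 1, xs 2} \<in> E"
    then obtain i j where ij: "i \<in> {3..?n}" "{xs 1, xs 2} = {xs i, xs j}" using U unfolding D_def by blast
    then have "xs i = xs 1 \<or> xs i = xs 2" by (auto simp: doubleton_eq_iff)
    then show False using xs_eq[of i 1] xs_eq[of i 2] ij(1) by auto
  qed
  have "two_back_graph E r (xs 1) (xs 2)"
  proof
    show "inj r" using r(2) by (metis injI)
    show "xs 1 \<noteq> xs 2" using xs_eq[of 1 2] n3 by simp
    show "simple_graph E" by (rule simple)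
    show "{v, t} \<notin> E" if v: "v \<in> {xs 1, xs 2}" and t: "r t < r v" for v t
    proof -
      have rx: "r (xs 1) = 1" "r (xs 2) = 2" using n3 by (auto intro: r_xs)
      have "r t \<ge> 1" using r(1)[of t] by simp
      then have "v = xs 2" "r t = 1" using v t rx by auto
      then have "t = xs 1" using r(2)[of t] by simp
      then show ?thesis using x12 \<open>v = xs 2\<close> by (simp add: insert_commute)
    qed
    show earlier: "\<exists>u w. u \<noteq> w \<and> r u < r v \<and> r w < r v \<and> {v, u} \<in> E \<and> {v, w} \<in> E \<and>
      (\<forall>t. r t < r v \<longrightarrow> {v, t} \<in> E \<longrightarrow> t = u \<or> t = w)" if v: "v \<notin> {xs 1, xs 2}" for v
    proof -
      define i where "i = r v"
      have v_eq: "v = xs i" and r_v: "r v = i" using r(2) by (simp_all add: i_def)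
      then have "i \<noteq> 1" "i \<noteq> 2" using v by auto
      then have i: "i \<in> {3..?n}" using r(1)[of v] by (simp add: i_def)
      obtain e1 e2 where e: "D i = {e1, e2}" "e1 \<noteq> e2" using two'[OF i] by (auto simp: card_2_iff)
      have ends: "\<exists>u. e = {v, u} \<and> r u < r v \<and> e \<in> E" if e_D: "e \<in> D i" for e
      proof -
        obtain j where j: "j \<in> {1..<i}" "e = {xs i, xs j}" "e \<in> E" using e_D by (auto simp: D_def)
        then have "r (xs j) = j" using i by (intro r_xs) auto
        then show ?thesis using j by (intro exI[of _ "xs j"]) (auto simp: r_v simp flip: v_eq)
      qed
      obtain u w where uw: "e1 = {v, u}" "r u < r v" "e1 \<in> E" "e2 = {v, w}" "r w < r v" "e2 \<in> E"
        using ends[of e1] ends[of e2] e(1) by auto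
      have "t = u \<or> t = w" if "r t < r v" "{v, t} \<in> E" for t
      proof -
        have "\<exists>j\<in>{1..<i}. {v, t} = {xs i, xs j}"
          using that(1) r[of t] by (intro bexI[of _ "r t"]) (auto simp: r_v simp flip: v_eq)
        then have "{v, t} \<in> D i" using that(2) unfolding D_def by blast
        then have "{v, t} = {v, u} \<or> {v, t} = {v, w}" using e uw by auto
        then show ?thesis by (auto simp: doubleton_eq_iff)
      qed
      moreover have "u \<noteq> w" using e(2) uw by auto
      ultimately show ?thesis using uw by (intro exI[of _ u] exI[of _ w]) simp
    qed
    show "\<exists>y. {xs 1, y} \<in> E \<and> {xs 2, y} \<in> E"
    proof -
      have r3: "r (xs 3) = 3" using n3 by (intro r_xs) auto
      have "xs 3 \<notin> {xs 1, xs 2}" using xs_eq[of 3 1] xs_eq[of 3 2] n3 by auto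
      from earlier[OF this] obtain u w where uw: "u \<noteq> w" "r u < 3" "r w < 3" "{xs 3, u} \<in> E" "{xs 3, w} \<in> E"
        unfolding r3 by blast
      have "t = xs 1 \<or> t = xs 2" if "r t < 3" for t
      proof -
        have "r t = 1 \<or> r t = 2" using that r(1)[of t] by auto
        then show ?thesis using r(2)[of t] by auto
      qed
      then have "(u = xs 1 \<and> w = xs 2) \<or> (u = xs 2 \<and> w = xs 1)" using uw(1-3) by blast
      then show ?thesis using uw(4,5) by (intro exI[of _ "xs 3"]) (auto simp: insert_commute)
    qed
  qed
  then show ?thesis by (simp add: r_def)
qed

lemma zariski_open_nonvanishing:
  fixes F :: "('i, 'k::field) mpoly"
  shows "zariski_open {c. peval c F \<noteq> 0}"
  unfolding zariski_open_def zariski_closed_def by (intro exI[of _ "{F}"]) auto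

context two_back_graph
begin

lemma ex_nbr: "\<exists>u. {v, u} \<in> E"
proof (cases "v \<in> {x1, x2}")
  case True
  then show ?thesis using common by auto
next
  case False
  then show ?thesis using two_earlier by blast
qed

text \<open>
  The vector \<open>c\<close> is looked for on the moment curve \<open>c v = s ^ r v\<close>. On it each determinant is a polynomial in \<open>s\<close>; since the
  exponents \<open>r v\<close> are distinct, the minors are its coefficients, and it is not the zero polynomial. A value of \<open>s\<close> outside the
  finitely many roots serves all triples at once.
\<close>

lemma ex_third_form:
  fixes a b :: "'v \<Rightarrow> 'k::field"
  assumes inf: "infinite (UNIV :: 'k set)"
    and minor: "\<And>u v. {u, v} \<in> E \<Longrightarrow> a u * b v - a v * b u \<noteq> 0"
  shows "\<exists>c. \<forall>v u w. u \<noteq> w \<longrightarrow> {v, u} \<in> E \<longrightarrow> {v, w} \<in> E \<longrightarrow> det3 a b c v u w \<noteq> 0"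
proof -
  define T where "T = {(v, u, w). u \<noteq> w \<and> {v, u} \<in> E \<and> {v, w} \<in> E}"
  define q where "q = (\<lambda>(v, u, w). monom (a v * b u - a u * b v) (r w) + monom (a w * b v - a v * b w) (r u)
    + monom (a u * b w - a w * b u) (r v))"
  have "q t \<noteq> 0" if "t \<in> T" for t
  proof -
    obtain v u w where t: "t = (v, u, w)" by (cases t)
    then have vuw: "u \<noteq> w" "{v, u} \<in> E" "{v, w} \<in> E" using that by (auto simp: T_def)
    have "r w \<noteq> r u" "r w \<noteq> r v" using inj_r vuw(1) edge_neq[OF vuw(3)] by (auto dest: injD)
    then have "coeff (q t) (r w) = a v * b u - a u * b v" by (simp add: q_def t)
    then show ?thesis using minor[OF vuw(2)] by auto
  qed
  then have "(\<Prod>t\<in>T. q t) \<noteq> 0" by simp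
  then have "finite {s. poly (\<Prod>t\<in>T. q t) s = 0}" by (rule poly_roots_finite)
  then obtain s where s: "poly (\<Prod>t\<in>T. q t) s \<noteq> 0" using inf by (metis (mono_tags) UNIV_eq_I mem_Collect_eq)
  have "det3 a b (\<lambda>v. s ^ r v) v u w \<noteq> 0" if "u \<noteq> w" "{v, u} \<in> E" "{v, w} \<in> E" for v u w
  proof -
    have "poly (q (v, u, w)) s \<noteq> 0" using s that by (auto simp: poly_prod T_def)
    also have "poly (q (v, u, w)) s = det3 a b (\<lambda>v. s ^ r v) v u w"
      by (simp add: q_def det3_def poly_monom algebra_simps)
    finally show ?thesis .
  qed
  then show ?thesis by blast
qed

lemma minor_locus:
  assumes inf: "infinite (UNIV :: 'k::field set)"
  defines "U \<equiv> {c :: 'v + 'v \<Rightarrow> 'k. \<forall>u v. {u, v} \<in> E \<longrightarrow> c (Inl u) * c (Inr v) - c (Inl v) * c (Inr u) \<noteq> 0}"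
  shows "zariski_open U" "U \<noteq> {}"
proof -
  define T where "T = {(u, v). {u, v} \<in> E}"
  define F :: "('v + 'v, 'k) mpoly" where
    "F = (\<Prod>(u, v)\<in>T. Var (Inl u) * Var (Inr v) - Var (Inl v) * Var (Inr u))"
  interpret scalar_hom "id :: 'k \<Rightarrow> 'k" by unfold_locales auto
  have "peval c F = (\<Prod>(u, v)\<in>T. c (Inl u) * c (Inr v) - c (Inl v) * c (Inr u))" for c
    unfolding peval_eq_insertion F_def by (simp add: insertion_simps case_prod_unfold)
  then have "U = {c. peval c F \<noteq> 0}" by (auto simp: U_def T_def)
  then show "zariski_open U" by (simp add: zariski_open_nonvanishing)
  obtain t :: "nat \<Rightarrow> 'k" where t: "inj t" using infinite_countable_subset[OF inf] by blast
  have "t (r v) - t (r u) \<noteq> 0" if "{u, v} \<in> E" for u v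
    using t inj_r edge_neq[OF that] by (auto dest: injD)
  then have "case_sum (\<lambda>_. 1) (\<lambda>v. t (r v)) \<in> U" by (simp add: U_def)
  then show "U \<noteq> {}" by blast
qed

lemma system_of_parameters_and_WLP:
  fixes a b :: "'v \<Rightarrow> 'k::field"
  assumes inf: "infinite (UNIV :: 'k set)"
    and minor: "\<And>u v. {u, v} \<in> E \<Longrightarrow> a u * b v - a v * b u \<noteq> 0"
  shows "SR_system_of_parameters E [linear_form a, linear_form b]"
    "SR_quot_WLP E {linear_form a, linear_form b}"
proof -
  have nz: "a v \<noteq> 0 \<or> b v \<noteq> 0" for v
    using ex_nbr[of v] minor[of v] by fastforce
  obtain c where "\<And>v u w. u \<noteq> w \<Longrightarrow> {v, u} \<in> E \<Longrightarrow> {v, w} \<in> E \<Longrightarrow> det3 a b c v u w \<noteq> 0"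
    using ex_third_form[of a b, OF inf minor] by blast
  then show "SR_quot_WLP E {linear_form a, linear_form b}" by (rule SR_quot_WLP[OF nz])
  obtain y where y: "{x1, y} \<in> E" using common by blast
  have "krull_dim (SR_ring E :: ('v, 'k) mpoly set ring) = 2"
    by (rule krull_dim_SR_ring[OF y edge_neq[OF y]])
  moreover have "Var u * Var v * Var w \<in> SR_quot_kernel E {linear_form a, linear_form b}" for u v w
    by (rule cubic_mem_ideal[where ?c1.0 = a and ?c2.0 = b, OF ideal_SR_quot_kernel SR_gens_subset_kernel])
       (use subset_SR_quot_kernel[of "{linear_form a, linear_form b}" E] minor nz in auto)
  then have "ring.finite_dimension (SR_quot E {linear_form a, linear_form b})
       (SR_quot_class E {linear_form a, linear_form b} ` range Const)
       (carrier (SR_quot E {linear_form a, linear_form b}))"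
    by (rule SR_quot_finite_dimension[OF one_notin_SR_quot_kernel])
  moreover have "\<exists>d>0. homogeneous d (linear_form c)" for c :: "'v \<Rightarrow> 'k"
    using homogeneous_linear_form[of c] by (intro exI[of _ 1]) simp
  ultimately show "SR_system_of_parameters E [linear_form a, linear_form b]"
    by (simp add: SR_system_of_parameters_def numeral_eq_enat numeral_2_eq_2)
qed

end

theorem proposition3p8:
  fixes E :: "'v::finite set set"
    and xs :: "nat \<Rightarrow> 'v"
  assumes "infinite (UNIV :: 'k::field set)"
    and "simple_graph E"
    and "connected_graph E"
    and "int (card E) = 2 * int CARD('v) - 4"
    and "bij_betw xs {1..CARD('v)} UNIV"
    and "\<forall>i\<in>{3..CARD('v)}. card {e\<in>E. \<exists>j\<in>{1..<i}. e = {xs i, xs j}} \<ge> 2"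
  shows "(\<exists>U :: ('v + 'v \<Rightarrow> 'k) set. zariski_open U \<and> U \<noteq> {} \<and>
            (\<forall>c\<in>U. let l1 = linear_form (\<lambda>v. c (Inl v));
                        l2 = linear_form (\<lambda>v. c (Inr v))
                    in SR_system_of_parameters E [l1, l2] \<and> SR_quot_WLP E {l1, l2})) \<and>
         (\<forall>A B. bipartition E A B \<longrightarrow>
            (let l1 = (\<Sum>x\<in>A. Var x :: ('v, 'k) mpoly);
                 l2 = (\<Sum>y\<in>B. Var y)
             in \<exists>a b. exact_zero_divisors (SR_quot E {l1, l2}) a b))"
proof -
  define r where "r = inv_into {1..CARD('v)} xs"
  interpret two_back_graph E r "xs 1" "xs 2"
    unfolding r_def by (rule two_back_graph_if_ordering) fact+
  let ?U = "{c :: 'v + 'v \<Rightarrow> 'k. \<forall>u v. {u, v} \<in> E \<longrightarrow> c (Inl u) * c (Inr v) - c (Inl v) * c (Inr u) \<noteq> 0}"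
  have "SR_system_of_parameters E [linear_form (\<lambda>v. c (Inl v)), linear_form (\<lambda>v. c (Inr v))]"
    "SR_quot_WLP E {linear_form (\<lambda>v. c (Inl v)), linear_form (\<lambda>v. c (Inr v))}" if "c \<in> ?U" for c
    by (rule system_of_parameters_and_WLP[OF assms(1)], use that in blast)+
  moreover obtain t :: "nat \<Rightarrow> 'k" where t: "inj t" using infinite_countable_subset[OF assms(1)] by blast
  have "inj (t \<circ> r)" using t inj_r by (rule inj_compose)
  then have "inj_on (t \<circ> r) A" for A by (rule inj_on_subset) simp
  then have "\<exists>a b. exact_zero_divisors (SR_quot E {\<Sum>x\<in>A. Var x :: ('v, 'k) mpoly, \<Sum>y\<in>B. Var y}) a b"
    if "bipartition E A B" for A B
    using bipartite_exact_zero_divisors[OF that] by blast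
  ultimately show ?thesis
    unfolding Let_def using minor_locus[OF assms(1)] by (intro conjI exI[of _ ?U]) blast+
qed

end
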